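(* Let \(F_o\in\mathcal M\) be such that \((F_o,W)\) is split over \(\mathbb R\), and suppose that \(\beta:(a,\infty)\to\mathfrak h\) is a differentiable function satisfying the Lax equation \[\frac{d\beta}{dy}=-[\beta(y),L\beta(y)].\] Then there exist a function \(h:(a,\infty)\to H\), an element \(\tilde N\in\mathfrak h\) and a point \(\tilde F\in\check{\mathcal M}\) such that (a) \(h^{-1}(y)\frac{dh}{dy}=-L\beta(y)\) and \(\beta(y)=\mathrm{Ad}(h^{-1}(y))\tilde N\); (b) \(h(y).F_o=e^{iy\tilde N}.\tilde F\).
   Context: \(V_{\mathbb Q}\) finite-dimensional over \(\mathbb Q\), \(V=V_{\mathbb Q}\otimes\mathbb C\), \(W\) an increasing rational filtration, \(Q=\{Q_k\}\) nondegenerate rational bilinear forms on \(Gr^W_k\) of parity \((-1)^k\); \(\mathcal M\) the set of decreasing filtrations (fixed \(\dim F^p\)) with \((F,W)\) a mixed Hodge structure graded-polarized by \(Q\). \(G=\{g\in GL(V):g\text{ preserves }W,\ Gr(g)\text{ real automorphism of }Q\}\); \(G_{\mathbb C}\) analogous with complex automorphisms, \(\mathfrak g_{\mathbb C}=\mathrm{Lie}(G_{\mathbb C})\), \(\check{\mathcal M}\) the \(G_{\mathbb C}\)-orbit of \(\mathcal M\). \(H=\{g\in G: g\text{ induces real automorphisms of }W_k/W_{k-2}\ \forall k\}\), \(\mathfrak h=\mathrm{Lie}(H)\). Deligne bigrading of \((F_o,W)\): unique \(V=\bigoplus I^{p,q}\) with \(F_o^p=\bigoplus_{a\ge p}I^{a,b}\),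 \(W_k=\bigoplus_{a+b\le k}I^{a,b}\), \(\overline{I^{p,q}}\equiv I^{q,p}\bmod\bigoplus_{r<q,s<p}I^{r,s}\) (split over \(\mathbb R\): equality). \(\mathfrak g^{r,s}_{\mathbb C}\) = elements of \(\mathfrak g_{\mathbb C}\) mapping \(I^{p,q}\) into \(I^{p+r,q+s}\); \(\eta_+=\bigoplus_{r\ge0,s<0}\mathfrak g^{r,s}_{\mathbb C}\), \(\eta_0=\mathfrak g^{0,0}_{\mathbb C}\), \(\eta_-=\bigoplus_{r<0,s\ge0}\mathfrak g^{r,s}_{\mathbb C}\), \(\Lambda=\bigoplus_{r,s<0}\mathfrak g^{r,s}_{\mathbb C}\), so \(\mathfrak g_{\mathbb C}=\eta_+\oplus\eta_0\oplus\eta_-\oplus\Lambda\). \(L\) is the endomorphism acting as \(+i\) on \(\eta_+\), \(0\) on \(\eta_0\), \(-i\) on \(\eta_-\oplus\Lambda\); it restricts to an endomorphism of \(\mathfrak h\). *)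

theory Defs
  imports "HOL-Analysis.Analysis"
begin

text \<open>The rational vector space V_Q is modelled (after choice of a Q-basis) as Q^n, and
  V = V_Q (x) C as complex^'n, 'n a finite index type.  Complex subspaces are the
  subspaces of the library vector space interpretation vec over scalar
  multiplication (*s).  Endomorphisms of V are matrices complex^'n^'n.\<close>

definition cnjv :: "complex^'n \<Rightarrow> complex^'n" where
  "cnjv v = (\<chi> i. cnj (v $ i))"

definition cnjS :: "(complex^'n) set \<Rightarrow> (complex^'n) set" where
  "cnjS S = cnjv ` S"

definition setplus :: "(complex^'n) set \<Rightarrow> (complex^'n) set \<Rightarrow> (complex^'n) set" where
  "setplus A B = {x + y | x y. x \<in> A \<and> y \<in> B}"

definition rational_vec :: "complex^'n \<Rightarrow> bool" where
  "rational_vec v \<longleftrightarrow> (\<forall>i. v $ i \<in> \<rat>)"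

text \<open>A subspace of V defined over Q (spanned by rational vectors).\<close>
definition rational_subspace :: "(complex^'n) set \<Rightarrow> bool" where
  "rational_subspace S \<longleftrightarrow> vec.subspace S \<and> S = vec.span (S \<inter> {v. rational_vec v})"

text \<open>Increasing rational filtration (finite: exhaustive and separated).\<close>
definition rational_inc_filtration :: "(int \<Rightarrow> (complex^'n) set) \<Rightarrow> bool" where
  "rational_inc_filtration W \<longleftrightarrow>
     (\<forall>k. rational_subspace (W k) \<and> W k \<subseteq> W (k + 1)) \<and>
     (\<exists>a b. W a = {0} \<and> W b = UNIV)"

text \<open>Decreasing filtration (finite: exhaustive and separated).\<close>
definition dec_filtration :: "(int \<Rightarrow> (complex^'n) set) \<Rightarrow> bool" where
  "dec_filtration F \<longleftrightarrow>
     (\<forall>p. vec.subspace (F p) \<and> F (p + 1) \<subseteq> F p) \<and>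
     (\<exists>a b. F a = UNIV \<and> F b = {0})"

definition cbilinear :: "(complex^'n \<Rightarrow> complex^'n \<Rightarrow> complex) \<Rightarrow> bool" where
  "cbilinear B \<longleftrightarrow>
     (\<forall>c x x' y. B (c *s x + x') y = c * B x y + B x' y) \<and>
     (\<forall>c x y y'. B x (c *s y + y') = c * B x y + B x y')"

text \<open>Q k is a bilinear form on V whose restriction to W_k x W_k descends to a
  nondegenerate rational bilinear form on Gr^W_k = W_k / W_(k-1) of parity (-1)^k.\<close>
definition graded_polarization ::
  "(int \<Rightarrow> (complex^'n) set) \<Rightarrow> (int \<Rightarrow> complex^'n \<Rightarrow> complex^'n \<Rightarrow> complex) \<Rightarrow> bool" where
  "graded_polarization W Q \<longleftrightarrow> (\<forall>k.
     cbilinear (Q k) \<and>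
     (\<forall>x\<in>W k. \<forall>y\<in>W (k - 1). Q k x y = 0 \<and> Q k y x = 0) \<and>
     (\<forall>x\<in>W k. (\<forall>y\<in>W k. Q k x y = 0) \<longrightarrow> x \<in> W (k - 1)) \<and>
     (\<forall>x\<in>W k. \<forall>y\<in>W k. rational_vec x \<longrightarrow> rational_vec y \<longrightarrow> Q k x y \<in> \<rat>) \<and>
     (\<forall>x\<in>W k. \<forall>y\<in>W k. Q k y x = (if even k then 1 else -1) * Q k x y))"

text \<open>Preimage in W_k of the subspace F^p Gr^W_k.\<close>
definition grF :: "(int \<Rightarrow> (complex^'n) set) \<Rightarrow> (int \<Rightarrow> (complex^'n) set) \<Rightarrow> int \<Rightarrow> int \<Rightarrow> (complex^'n) set" where
  "grF W F k p = setplus (F p \<inter> W k) (W (k - 1))"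

text \<open>(F,W) is a mixed Hodge structure graded-polarized by Q: on every Gr^W_k the
  filtration induced by F is a pure Hodge structure of weight k polarized by Q_k.\<close>
definition is_gpmhs ::
  "(int \<Rightarrow> (complex^'n) set) \<Rightarrow> (int \<Rightarrow> complex^'n \<Rightarrow> complex^'n \<Rightarrow> complex) \<Rightarrow>
   (int \<Rightarrow> (complex^'n) set) \<Rightarrow> bool" where
  "is_gpmhs W Q F \<longleftrightarrow> (\<forall>k p.
     setplus (grF W F k p) (cnjS (grF W F k (k - p + 1))) = W k \<and>
     grF W F k p \<inter> cnjS (grF W F k (k - p + 1)) = W (k - 1) \<and>
     (\<forall>x\<in>grF W F k p. \<forall>y\<in>grF W F k (k - p + 1). Q k x y = 0) \<and>
     (\<forall>x\<in>grF W F k p \<inter> cnjS (grF W F k (k - p)). x \<notin> W (k - 1) \<longrightarrow>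
        Im (\<i> powi (2 * p - k) * Q k x (cnjv x)) = 0 \<and>
        Re (\<i> powi (2 * p - k) * Q k x (cnjv x)) > 0))"

text \<open>The classifying space M (fixed dimensions d p = dim F^p).\<close>
definition Mset ::
  "(int \<Rightarrow> (complex^'n) set) \<Rightarrow> (int \<Rightarrow> complex^'n \<Rightarrow> complex^'n \<Rightarrow> complex) \<Rightarrow> (int \<Rightarrow> nat) \<Rightarrow>
   (int \<Rightarrow> (complex^'n) set) set" where
  "Mset W Q d = {F. dec_filtration F \<and> (\<forall>p. vec.dim (F p) = d p) \<and> is_gpmhs W Q F}"

definition act :: "complex^'n^'n \<Rightarrow> (int \<Rightarrow> (complex^'n) set) \<Rightarrow> (int \<Rightarrow> (complex^'n) set)" where
  "act g F = (\<lambda>p. (\<lambda>v. g *v v) ` F p)"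

text \<open>The group G_C, G and H.\<close>
definition GCgrp ::
  "(int \<Rightarrow> (complex^'n) set) \<Rightarrow> (int \<Rightarrow> complex^'n \<Rightarrow> complex^'n \<Rightarrow> complex) \<Rightarrow> (complex^'n^'n) set" where
  "GCgrp W Q = {g. invertible g \<and> (\<forall>k. (\<forall>x\<in>W k. g *v x \<in> W k) \<and>
      (\<forall>x\<in>W k. \<forall>y\<in>W k. Q k (g *v x) (g *v y) = Q k x y))}"

definition Ggrp ::
  "(int \<Rightarrow> (complex^'n) set) \<Rightarrow> (int \<Rightarrow> complex^'n \<Rightarrow> complex^'n \<Rightarrow> complex) \<Rightarrow> (complex^'n^'n) set" where
  "Ggrp W Q = {g \<in> GCgrp W Q. \<forall>k. \<forall>x\<in>W k. cnjv (g *v x) - g *v cnjv x \<in> W (k - 1)}"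

definition Hgrp ::
  "(int \<Rightarrow> (complex^'n) set) \<Rightarrow> (int \<Rightarrow> complex^'n \<Rightarrow> complex^'n \<Rightarrow> complex) \<Rightarrow> (complex^'n^'n) set" where
  "Hgrp W Q = {g \<in> Ggrp W Q. \<forall>k. \<forall>x\<in>W k. cnjv (g *v x) - g *v cnjv x \<in> W (k - 2)}"

text \<open>Lie algebras g_C = Lie(G_C) and h = Lie(H), written out as sets of matrices.\<close>
definition gClie ::
  "(int \<Rightarrow> (complex^'n) set) \<Rightarrow> (int \<Rightarrow> complex^'n \<Rightarrow> complex^'n \<Rightarrow> complex) \<Rightarrow> (complex^'n^'n) set" where
  "gClie W Q = {X. \<forall>k. (\<forall>x\<in>W k. X *v x \<in> W k) \<and>
      (\<forall>x\<in>W k. \<forall>y\<in>W k. Q k (X *v x) y + Q k x (X *v y) = 0)}"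

definition hlie ::
  "(int \<Rightarrow> (complex^'n) set) \<Rightarrow> (int \<Rightarrow> complex^'n \<Rightarrow> complex^'n \<Rightarrow> complex) \<Rightarrow> (complex^'n^'n) set" where
  "hlie W Q = {X \<in> gClie W Q. \<forall>k. \<forall>x\<in>W k. cnjv (X *v x) - X *v cnjv x \<in> W (k - 2)}"

text \<open>The G_C-orbit of M.\<close>
definition Mcheck ::
  "(int \<Rightarrow> (complex^'n) set) \<Rightarrow> (int \<Rightarrow> complex^'n \<Rightarrow> complex^'n \<Rightarrow> complex) \<Rightarrow> (int \<Rightarrow> nat) \<Rightarrow>
   (int \<Rightarrow> (complex^'n) set) set" where
  "Mcheck W Q d = {act g F | g F. g \<in> GCgrp W Q \<and> F \<in> Mset W Q d}"

text \<open>Bigradings.\<close>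
definition bsupp :: "(int \<Rightarrow> int \<Rightarrow> (complex^'n) set) \<Rightarrow> (int \<times> int) set" where
  "bsupp I = {(p, q). I p q \<noteq> {0}}"

definition is_bigrading :: "(int \<Rightarrow> int \<Rightarrow> (complex^'n) set) \<Rightarrow> bool" where
  "is_bigrading I \<longleftrightarrow> (\<forall>p q. vec.subspace (I p q)) \<and> finite (bsupp I) \<and>
     (\<forall>v. \<exists>!x. (\<forall>p q. x (p, q) \<in> I p q) \<and> v = sum x (bsupp I))"

text \<open>Sum of the I^{a,b} over the (a,b) satisfying P.\<close>
definition bigsum :: "(int \<Rightarrow> int \<Rightarrow> (complex^'n) set) \<Rightarrow> (int \<Rightarrow> int \<Rightarrow> bool) \<Rightarrow> (complex^'n) set" where
  "bigsum I P = {sum x (bsupp I) | x. (\<forall>a b. x (a, b) \<in> I a b) \<and> (\<forall>a b. \<not> P a b \<longrightarrow> x (a, b) = 0)}"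

text \<open>I is the Deligne bigrading of (F,W).\<close>
definition deligne_bigrading ::
  "(int \<Rightarrow> (complex^'n) set) \<Rightarrow> (int \<Rightarrow> (complex^'n) set) \<Rightarrow> (int \<Rightarrow> int \<Rightarrow> (complex^'n) set) \<Rightarrow> bool" where
  "deligne_bigrading F W I \<longleftrightarrow> is_bigrading I \<and>
     (\<forall>p. F p = bigsum I (\<lambda>a b. a \<ge> p)) \<and>
     (\<forall>k. W k = bigsum I (\<lambda>a b. a + b \<le> k)) \<and>
     (\<forall>p q. cnjS (I p q) \<subseteq> setplus (I q p) (bigsum I (\<lambda>r s. r < q \<and> s < p)))"

text \<open>The Deligne bigrading is split over R.\<close>
definition split_over_R :: "(int \<Rightarrow> int \<Rightarrow> (complex^'n) set) \<Rightarrow> bool" where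
  "split_over_R I \<longleftrightarrow> (\<forall>p q. cnjS (I p q) = I q p)"

text \<open>Projection onto I^{p,q} along the other summands.\<close>
definition bproj :: "(int \<Rightarrow> int \<Rightarrow> (complex^'n) set) \<Rightarrow> int \<Rightarrow> int \<Rightarrow> complex^'n \<Rightarrow> complex^'n" where
  "bproj I p q v = (THE x. (\<forall>a b. x (a, b) \<in> I a b) \<and> v = sum x (bsupp I)) (p, q)"

text \<open>Eigenvalue of L on g^{r,s}: +i on eta_+ (r>=0, s<0), 0 on eta_0, -i on
  eta_- + Lambda (r<0). Components with r,s>=0, (r,s)<>(0,0) vanish on g_C.\<close>
definition Lcoef :: "int \<Rightarrow> int \<Rightarrow> complex" where
  "Lcoef r s = (if 0 \<le> r \<and> s < 0 then \<i> else if r < 0 then - \<i> else 0)"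

text \<open>L X = sum over (r,s) of Lcoef r s times the (r,s)-component X^{r,s} of X,
  where X^{r,s} = sum_{p,q} pi_{p+r,q+s} X pi_{p,q}.\<close>
definition Lop :: "(int \<Rightarrow> int \<Rightarrow> (complex^'n) set) \<Rightarrow> complex^'n^'n \<Rightarrow> complex^'n^'n" where
  "Lop I X = matrix (\<lambda>v. \<Sum>pq\<in>bsupp I. \<Sum>pq'\<in>bsupp I.
      Lcoef (fst pq' - fst pq) (snd pq' - snd pq) *s
        bproj I (fst pq') (snd pq') (X *v bproj I (fst pq) (snd pq) v))"

definition lie_bracket :: "complex^'n^'n \<Rightarrow> complex^'n^'n \<Rightarrow> complex^'n^'n" where
  "lie_bracket X Y = X ** Y - Y ** X"

definition cscaleM :: "complex \<Rightarrow> complex^'n^'n \<Rightarrow> complex^'n^'n" where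
  "cscaleM c A = (\<chi> i j. c * A $ i $ j)"

definition matpow :: "complex^'n^'n \<Rightarrow> nat \<Rightarrow> complex^'n^'n" where
  "matpow A k = ((\<lambda>B. A ** B) ^^ k) (mat 1)"

text \<open>Matrix exponential, defined by its power series (entrywise).\<close>
definition mexp :: "complex^'n^'n \<Rightarrow> complex^'n^'n" where
  "mexp A = (\<chi> i j. (\<Sum>k. (matpow A k) $ i $ j / of_nat (fact k)))"

end

(*
  Solve the linear equation h' = - h L(beta) with h(y0) = 1.  The Lax equation says precisely
  that h beta h^-1 has derivative zero, so beta = h^-1 N h with N = beta(y0).  Since L is built
  from the Deligne bigrading, which is split over R and orthogonal for the polarization, L maps
  the Lie algebra h into itself, and h stays in the group H.  On the components that lower the
  Hodge degree L acts as -i, so i beta + L beta stabilizes F_o.  Hence q(y) = e^(-iyN) h(y) solves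
  q' = - q (i beta + L beta), a linear equation inside the stabilizer of F_o, and therefore
  q(y) = q(y0) rho(y) with rho(y) F_o = F_o; this gives h(y) F_o = e^(iyN) e^(-i y0 N) F_o.
  Linear equations are solved by Picard iteration, the exponential by its power series.
*)
theory Submission
  imports Defs
begin

section \<open>Complex vectors, matrices and bilinear forms\<close>

lemma sum_eq_single:
  assumes "finite S" "\<And>x. x \<in> S \<Longrightarrow> x \<noteq> z \<Longrightarrow> g x = 0" "z \<notin> S \<Longrightarrow> g z = 0"
  shows "sum g S = g z"
proof (cases "z \<in> S")
  case True
  then have "sum g S = g z + sum g (S - {z})" using assms(1) by (simp add: sum.remove)
  also have "sum g (S - {z}) = 0" using assms(2) by (intro sum.neutral) auto
  finally show ?thesis by simp
qed (use assms in \<open>auto intro!: sum.neutral\<close>)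

lemma scaleR_vec_complex: "r *\<^sub>R (v::complex^'n) = complex_of_real r *s v"
  by (simp add: vec_eq_iff) (simp add: scaleR_conv_of_real)

lemma vec_subspace_imp_subspace: "vec.subspace (V :: (complex^'n) set) \<Longrightarrow> subspace V"
  unfolding subspace_def using vec.subspace_0 vec.subspace_add vec.subspace_scale
  by (auto simp: scaleR_vec_complex)

lemma cbilinear_simps:
  assumes "cbilinear B"
  shows cbilinear_zero_left: "B 0 y = 0" and cbilinear_zero_right: "B x 0 = 0"
    and cbilinear_add_left: "B (x + x') y = B x y + B x' y"
    and cbilinear_add_right: "B x (y + y') = B x y + B x y'"
    and cbilinear_scale_left: "B (c *s x) y = c * B x y"
    and cbilinear_scale_right: "B x (c *s y) = c * B x y"
proof -
  have l: "B (c *s x + x') y = c * B x y + B x' y" for c x x' y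
    using assms unfolding cbilinear_def by blast
  have r: "B x (c *s y + y') = c * B x y + B x y'" for c x y y'
    using assms unfolding cbilinear_def by blast
  show l0: "B 0 y = 0" for y using l[of 1 0 0 y] by simp
  show r0: "B x 0 = 0" for x using r[of x 1 0 0] by simp
  show "B (x + x') y = B x y + B x' y" using l[of 1 x x' y] by simp
  show "B x (y + y') = B x y + B x y'" using r[of x 1 y y'] by simp
  show "B (c *s x) y = c * B x y" using l[of c x 0 y] l0 by simp
  show "B x (c *s y) = c * B x y" using r[of x c y 0] r0 by simp
qed

lemma cbilinear_sum_left: "cbilinear B \<Longrightarrow> B (sum f S) y = (\<Sum>i\<in>S. B (f i) y)"
  by (induction S rule: infinite_finite_induct) (auto simp: cbilinear_zero_left cbilinear_add_left)

lemma cbilinear_sum_right: "cbilinear B \<Longrightarrow> B x (sum f S) = (\<Sum>i\<in>S. B x (f i))"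
  by (induction S rule: infinite_finite_induct) (auto simp: cbilinear_zero_right cbilinear_add_right)

lemma cbilinear_imp_bounded_bilinear:
  assumes B: "cbilinear B" shows "bounded_bilinear B"
proof -
  have "bilinear B"
    unfolding bilinear_def
    by (auto intro!: linearI simp: cbilinear_add_left[OF B] cbilinear_add_right[OF B]
        scaleR_vec_complex cbilinear_scale_left[OF B] cbilinear_scale_right[OF B] scaleR_conv_of_real)
  then show ?thesis by (simp add: bilinear_conv_bounded_bilinear)
qed

lemma cnjv_simps [simp]:
  "cnjv (x + y) = cnjv x + cnjv y" "cnjv 0 = 0" "cnjv (x - y) = cnjv x - cnjv y"
  "cnjv (- x) = - cnjv x" "cnjv (c *s x) = cnj c *s cnjv x" "cnjv (cnjv x) = x"
  "cnjv x $ i = cnj (x $ i)"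
  by (auto simp: cnjv_def vec_eq_iff)

lemma cnjv_sum: "cnjv (sum f S) = (\<Sum>i\<in>S. cnjv (f i))"
  by (induction S rule: infinite_finite_induct) auto

lemma cnjv_rational_vec: "rational_vec v \<Longrightarrow> cnjv v = v"
proof -
  have "cnj z = z" if "z \<in> \<rat>" for z :: complex
    using that by (auto elim!: Rats_cases simp: Reals_cnj_iff[symmetric] of_rat_def)
  then show "rational_vec v \<Longrightarrow> cnjv v = v" by (simp add: rational_vec_def vec_eq_iff)
qed

lemma matrix_vector_mult_sum: "(A::'a::semiring_1^'n^'m) *v sum f S = (\<Sum>i\<in>S. A *v f i)"
  by (induction S rule: infinite_finite_induct) (auto simp: matrix_vector_right_distrib)

lemma matrix_vector_mult_scaleR: "(r *\<^sub>R (A::complex^'n^'m)) *v v = complex_of_real r *s (A *v v)"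
  by (simp add: vec_eq_iff matrix_vector_mult_def sum_distrib_left scaleR_conv_of_real[where 'a=complex] mult_ac)

lemma matrix_add_rdistrib: "((A::'a::semiring_1^'n^'m) + B) ** C = A ** C + B ** C"
  by (simp add: vec_eq_iff matrix_matrix_mult_def sum.distrib distrib_right)

lemma matrix_mult_minus_simps:
  fixes A B C :: "'a::ring_1^'n^'n"
  shows matrix_mult_minus_left: "(- A) ** B = - (A ** B)"
    and matrix_mult_minus_right: "A ** (- B) = - (A ** B)"
    and matrix_diff_rdistrib: "(A - B) ** C = A ** C - B ** C"
    and matrix_diff_ldistrib: "A ** (B - C) = A ** B - A ** C"
  by (simp_all add: vec_eq_iff matrix_matrix_mult_def sum_negf sum_subtractf algebra_simps)

lemma bounded_bilinear_matrix_mult: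
  "bounded_bilinear (\<lambda>(A::complex^'n^'m) (B::complex^'k^'n). A ** B)"
proof -
  have "bilinear (\<lambda>(A::complex^'n^'m) (B::complex^'k^'n). A ** B)"
    unfolding bilinear_def
    by (auto intro!: linearI simp: matrix_add_rdistrib matrix_add_ldistrib matrix_scalar_ac scalar_matrix_assoc)
  then show ?thesis by (simp add: bilinear_conv_bounded_bilinear)
qed

lemma bounded_bilinear_matrix_vector_mult:
  "bounded_bilinear (\<lambda>(A::complex^'n^'m) (v::complex^'n). A *v v)"
proof -
  have "bilinear (\<lambda>(A::complex^'n^'m) (v::complex^'n). A *v v)"
    unfolding bilinear_def
    by (auto intro!: linearI simp: matrix_vector_mult_add_rdistrib matrix_vector_right_distrib
        vec_eq_iff matrix_vector_mult_def sum_distrib_left mult_ac sum.distrib distrib_left)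
      (simp add: scaleR_conv_of_real mult_ac sum_distrib_left)
  then show ?thesis by (simp add: bilinear_conv_bounded_bilinear)
qed

lemma matrix_inv_eq:
  fixes A B :: "'a::field^'n^'n"
  assumes AB: "A ** B = mat 1"
  shows "matrix_inv A = B"
proof -
  have BA: "B ** A = mat 1" using AB matrix_left_right_inverse by blast
  have inv: "A ** matrix_inv A = mat 1 \<and> matrix_inv A ** A = mat 1"
    unfolding matrix_inv_def by (rule someI[of _ B]) (use AB BA in blast)
  have "matrix_inv A = matrix_inv A ** (A ** B)" by (simp add: AB)
  also have "\<dots> = (matrix_inv A ** A) ** B" by (simp add: matrix_mul_assoc)
  also have "\<dots> = B" using inv by simp
  finally show ?thesis .
qed

lemma cscaleM_simps:
  shows cscaleM_matrix_vector_mult: "cscaleM c A *v v = c *s (A *v v)"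
    and cscaleM_mult_left: "cscaleM c A ** B = cscaleM c (A ** B)"
    and cscaleM_mult_right: "A ** cscaleM c B = cscaleM c (A ** B)"
    and cscaleM_eq_mat_mult: "cscaleM c A = mat c ** A"
  by (simp_all add: cscaleM_def vec_eq_iff matrix_vector_mult_def matrix_matrix_mult_def
      sum_distrib_left mult_ac mat_def if_distrib if_distribR cong: if_cong)

lemma act_matrix_mult: "act (A ** B) F = act A (act B F)"
  unfolding act_def by (simp add: image_image matrix_vector_mul_assoc fun_eq_iff)

definition stabilizer :: "('i \<Rightarrow> (complex^'n) set) \<Rightarrow> (complex^'n^'n) set" where
  "stabilizer V = {X. \<forall>i. \<forall>x\<in>V i. X *v x \<in> V i}"

lemma stabilizer_mult: "X \<in> stabilizer V \<Longrightarrow> Y \<in> stabilizer V \<Longrightarrow> X ** Y \<in> stabilizer V"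
  unfolding stabilizer_def by (simp add: matrix_vector_mul_assoc[symmetric])

lemma mat_1_stabilizer: "mat 1 \<in> stabilizer V"
  unfolding stabilizer_def by simp

lemma subspace_stabilizer:
  assumes "\<And>i. vec.subspace (V i)" shows "subspace (stabilizer V)"
  unfolding subspace_def stabilizer_def
  by (auto simp: matrix_vector_mult_add_rdistrib matrix_vector_mult_scaleR
      vec.subspace_add[OF assms] vec.subspace_0[OF assms] vec.subspace_scale[OF assms])

section \<open>Bigradings\<close>

definition bcomp :: "(int \<Rightarrow> int \<Rightarrow> (complex^'n) set) \<Rightarrow> complex^'n \<Rightarrow> int \<times> int \<Rightarrow> complex^'n" where
  "bcomp I v = (THE x. (\<forall>a b. x (a, b) \<in> I a b) \<and> v = sum x (bsupp I))"

lemma bproj_eq_bcomp: "bproj I p q v = bcomp I v (p, q)"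
  unfolding bproj_def bcomp_def ..

locale bigrading =
  fixes I :: "int \<Rightarrow> int \<Rightarrow> (complex^'n) set"
  assumes is_bigrading: "is_bigrading I"
begin

lemma subspace_I: "vec.subspace (I a b)"
  using is_bigrading unfolding is_bigrading_def by blast

lemma finite_bsupp: "finite (bsupp I)"
  using is_bigrading unfolding is_bigrading_def by blast

lemma bcomp_props: "(\<forall>a b. bcomp I v (a, b) \<in> I a b) \<and> v = sum (bcomp I v) (bsupp I)"
  and bcomp_unique: "(\<And>a b. x (a, b) \<in> I a b) \<Longrightarrow> v = sum x (bsupp I) \<Longrightarrow> bcomp I v = x"
proof -
  have ex1: "\<exists>!x. (\<forall>p q. x (p, q) \<in> I p q) \<and> v = sum x (bsupp I)" for v
    using is_bigrading unfolding is_bigrading_def by blast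
  show "(\<forall>a b. bcomp I v (a, b) \<in> I a b) \<and> v = sum (bcomp I v) (bsupp I)"
    unfolding bcomp_def by (rule theI'[OF ex1])
  show "bcomp I v = x" if "\<And>a b. x (a, b) \<in> I a b" "v = sum x (bsupp I)"
    unfolding bcomp_def using that by (intro the1_equality[OF ex1]) auto
qed

lemma bcomp_mem: "bcomp I v pq \<in> I (fst pq) (snd pq)"
  using bcomp_props[of v] by (cases pq) auto

lemma sum_bcomp: "sum (bcomp I v) (bsupp I) = v"
  using bcomp_props[of v] by simp

lemma bcomp_outside: "pq \<notin> bsupp I \<Longrightarrow> bcomp I v pq = 0"
  using bcomp_mem[of v pq] unfolding bsupp_def by (cases pq) auto

lemma bcomp_add: "bcomp I (v + w) pq = bcomp I v pq + bcomp I w pq"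
proof -
  have "bcomp I (v + w) = (\<lambda>pq. bcomp I v pq + bcomp I w pq)"
    by (rule bcomp_unique) (auto intro: vec.subspace_add[OF subspace_I] bcomp_mem[of _ "(_, _)", simplified]
        simp: sum.distrib sum_bcomp)
  then show ?thesis by simp
qed

lemma bcomp_scale: "bcomp I (c *s v) pq = c *s bcomp I v pq"
proof -
  have "bcomp I (c *s v) = (\<lambda>pq. c *s bcomp I v pq)"
    by (rule bcomp_unique) (auto intro: vec.subspace_scale[OF subspace_I] bcomp_mem[of _ "(_, _)", simplified]
        simp: vec.scale_sum_right[symmetric] sum_bcomp)
  then show ?thesis by simp
qed

lemma bcomp_zero: "bcomp I 0 pq = 0"
  using bcomp_scale[of 0 0 pq] by simp

lemma bcomp_diff: "bcomp I (v - w) pq = bcomp I v pq - bcomp I w pq"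
  using bcomp_add[of v "- w" pq] bcomp_scale[of "-1" w pq] by simp

lemma bcomp_sum: "bcomp I (sum f S) pq = (\<Sum>i\<in>S. bcomp I (f i) pq)"
  by (induction S rule: infinite_finite_induct) (auto simp: bcomp_zero bcomp_add)

lemma bcomp_single:
  assumes "u \<in> I p q"
  shows "bcomp I u pq = (if pq = (p, q) then u else 0)"
proof -
  have "bcomp I u = (\<lambda>pq. if pq = (p, q) then u else 0)"
  proof (rule bcomp_unique)
    show "(if (a, b) = (p, q) then u else 0) \<in> I a b" for a b
      using assms vec.subspace_0[OF subspace_I] by auto
    show "u = (\<Sum>pq\<in>bsupp I. if pq = (p, q) then u else 0)"
    proof (cases "(p, q) \<in> bsupp I")
      case True then show ?thesis using finite_bsupp by simp
    next
      case False then have "u = 0" using assms unfolding bsupp_def by auto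
      then show ?thesis by (simp add: if_distrib cong: if_cong)
    qed
  qed
  then show ?thesis by simp
qed

lemma bcomp_bcomp: "bcomp I (bcomp I v pq) pq' = (if pq' = pq then bcomp I v pq else 0)"
  using bcomp_single[OF bcomp_mem[of v pq]] by simp

lemma mem_bigsum_iff: "v \<in> bigsum I P \<longleftrightarrow> (\<forall>a b. \<not> P a b \<longrightarrow> bcomp I v (a, b) = 0)"
proof
  assume "v \<in> bigsum I P"
  then obtain x where x: "\<forall>a b. x (a, b) \<in> I a b" "\<forall>a b. \<not> P a b \<longrightarrow> x (a, b) = 0" "v = sum x (bsupp I)"
    unfolding bigsum_def by blast
  then have "bcomp I v = x" by (intro bcomp_unique) auto
  then show "\<forall>a b. \<not> P a b \<longrightarrow> bcomp I v (a, b) = 0" using x by simp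
next
  assume "\<forall>a b. \<not> P a b \<longrightarrow> bcomp I v (a, b) = 0"
  then show "v \<in> bigsum I P" unfolding bigsum_def using bcomp_props[of v] by blast
qed

end

section \<open>The split Deligne bigrading of the base point\<close>

locale split_gpmhs =
  fixes W :: "int \<Rightarrow> (complex^'n) set"
    and Q :: "int \<Rightarrow> complex^'n \<Rightarrow> complex^'n \<Rightarrow> complex"
    and d :: "int \<Rightarrow> nat"
    and Fo :: "int \<Rightarrow> (complex^'n) set"
    and I :: "int \<Rightarrow> int \<Rightarrow> (complex^'n) set"
  assumes W: "rational_inc_filtration W"
    and Q: "graded_polarization W Q"
    and Fo: "Fo \<in> Mset W Q d"
    and deligne: "deligne_bigrading Fo W I"
    and split: "split_over_R I"
begin

sublocale bigrading I
  using deligne unfolding deligne_bigrading_def by unfold_locales blast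

lemma mem_W_iff: "v \<in> W k \<longleftrightarrow> (\<forall>a b. k < a + b \<longrightarrow> bcomp I v (a, b) = 0)"
  using deligne mem_bigsum_iff unfolding deligne_bigrading_def by (simp add: not_le)

lemma mem_Fo_iff: "v \<in> Fo p \<longleftrightarrow> (\<forall>a b. a < p \<longrightarrow> bcomp I v (a, b) = 0)"
  using deligne mem_bigsum_iff unfolding deligne_bigrading_def by (simp add: not_le)

lemma subspace_W: "vec.subspace (W k)"
  using W unfolding rational_inc_filtration_def rational_subspace_def by blast

lemma subspace_Fo: "vec.subspace (Fo p)"
  using Fo unfolding Mset_def dec_filtration_def by blast

lemma I_in_W: "u \<in> I a b \<Longrightarrow> a + b \<le> k \<Longrightarrow> u \<in> W k"
  unfolding mem_W_iff by (auto simp: bcomp_single)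

lemma I_in_Fo: "u \<in> I a b \<Longrightarrow> p \<le> a \<Longrightarrow> u \<in> Fo p"
  unfolding mem_Fo_iff by (auto simp: bcomp_single)

lemma W_mono: "j \<le> k \<Longrightarrow> x \<in> W j \<Longrightarrow> x \<in> W k"
  unfolding mem_W_iff by auto

lemma weight_bcomp_le: "v \<in> W k \<Longrightarrow> bcomp I v pq \<noteq> 0 \<Longrightarrow> fst pq + snd pq \<le> k"
  unfolding mem_W_iff by (cases pq) (auto simp: not_le[symmetric])

lemma cnjv_I: "u \<in> I a b \<Longrightarrow> cnjv u \<in> I b a"
  using split unfolding split_over_R_def cnjS_def by blast

lemma swap_image_bsupp: "prod.swap ` bsupp I = bsupp I"
proof -
  have "I a b = {0}" if "I b a = {0}" for a b
    using split that unfolding split_over_R_def cnjS_def by (metis cnjv_simps(2) image_empty image_insert)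
  then have sw: "prod.swap pq \<in> bsupp I" if "pq \<in> bsupp I" for pq
    using that unfolding bsupp_def by (cases pq) auto
  show ?thesis
  proof
    show "prod.swap ` bsupp I \<subseteq> bsupp I" using sw by blast
    show "bsupp I \<subseteq> prod.swap ` bsupp I"
      using sw by (metis image_eqI subsetI swap_swap)
  qed
qed

lemma bcomp_cnjv: "bcomp I (cnjv v) pq = cnjv (bcomp I v (prod.swap pq))"
proof -
  have "bcomp I (cnjv v) = (\<lambda>pq. cnjv (bcomp I v (prod.swap pq)))"
  proof (rule bcomp_unique)
    show "cnjv (bcomp I v (prod.swap (a, b))) \<in> I a b" for a b
      using cnjv_I[OF bcomp_mem[of v "(b, a)"]] by simp
    have "(\<Sum>pq\<in>bsupp I. bcomp I v (prod.swap pq)) = (\<Sum>pq\<in>prod.swap ` bsupp I. bcomp I v pq)"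
      by (subst sum.reindex) (auto simp: o_def)
    then show "cnjv v = (\<Sum>pq\<in>bsupp I. cnjv (bcomp I v (prod.swap pq)))"
      by (simp add: swap_image_bsupp sum_bcomp cnjv_sum[symmetric])
  qed
  then show ?thesis by simp
qed

lemma cbilinear_Q: "cbilinear (Q k)"
  using Q unfolding graded_polarization_def by blast

lemma Q_lower: "x \<in> W k \<Longrightarrow> y \<in> W (k - 1) \<Longrightarrow> Q k x y = 0 \<and> Q k y x = 0"
  using Q unfolding graded_polarization_def by blast

lemma Q_sym: "x \<in> W k \<Longrightarrow> y \<in> W k \<Longrightarrow> Q k y x = (if even k then 1 else -1) * Q k x y"
  using Q unfolding graded_polarization_def by blast

text \<open>\<open>Q\<^sub>k\<close> is rational on the rational vectors, which span \<open>W\<^sub>k\<close>.\<close>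
lemma Q_cnjv:
  assumes x: "x \<in> W k" and y: "y \<in> W k"
  shows "Q k (cnjv x) (cnjv y) = cnj (Q k x y)"
proof -
  define R where "R = W k \<inter> {v. rational_vec v}"
  have span: "W k = vec.span R"
    using W unfolding R_def rational_inc_filtration_def rational_subspace_def by blast
  have QR: "Q k r s \<in> \<rat>" if "r \<in> R" "s \<in> R" for r s
    using Q that unfolding R_def graded_polarization_def by blast
  have left: "\<forall>s\<in>R. Q k (cnjv x') (cnjv s) = cnj (Q k x' s)" if "x' \<in> vec.span R" for x'
    using that
  proof (induction rule: vec.span_induct)
    case (step r)
    show ?case
    proof
      fix s assume s: "s \<in> R"
      have "cnjv r = r" "cnjv s = s" using cnjv_rational_vec step s unfolding R_def by auto
      moreover have "cnj (Q k r s) = Q k r s"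
        using QR[OF step s] by (auto elim!: Rats_cases simp: Reals_cnj_iff[symmetric] of_rat_def)
      ultimately show "Q k (cnjv r) (cnjv s) = cnj (Q k r s)" by simp
    qed
  qed (auto simp: vec.subspace_def cbilinear_simps[OF cbilinear_Q])
  have "\<forall>x'\<in>vec.span R. Q k (cnjv x') (cnjv y') = cnj (Q k x' y')" if "y' \<in> vec.span R" for y'
    using that
  proof (induction rule: vec.span_induct)
    case step
    then show ?case using left by blast
  qed (auto simp: vec.subspace_def cbilinear_simps[OF cbilinear_Q])
  then show ?thesis using x y span by blast
qed

lemma gpmhs: "is_gpmhs W Q Fo"
  using Fo unfolding Mset_def by blast

text \<open>For \<open>a + a' > k\<close> this is the polarization condition \<open>Q\<^sub>k(F\<^sup>a, F\<^sup>k\<^sup>-\<^sup>a\<^sup>+\<^sup>1) = 0\<close> on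
  \<open>Gr\<^sup>W\<^sub>k\<close>; the case \<open>a + a' < k\<close> follows by conjugation, as \<open>I\<close> is split over \<open>\<real>\<close>.\<close>
lemma Q_I_orthogonal:
  assumes u: "u \<in> I a b" and w: "w \<in> I a' b'" and k: "a + b = k" "a' + b' = k" and ne: "a + a' \<noteq> k"
  shows "Q k u w = 0"
proof -
  have high: "Q k u w = 0"
    if u: "u \<in> I a b" and w: "w \<in> I a' b'" and "a + b = k" "a' + b' = k" "k < a + a'" for u w a b a' b'
  proof -
    have grF: "x \<in> grF W Fo k p" if "x \<in> Fo p" "x \<in> W k" for x p
      unfolding grF_def setplus_def mem_Collect_eq
      by (intro exI[of _ x] exI[of _ 0]) (simp add: that vec.subspace_0[OF subspace_W])
    have "u \<in> grF W Fo k a"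
      using that by (intro grF I_in_Fo[OF u] I_in_W[OF u]) auto
    moreover have "w \<in> grF W Fo k (k - a + 1)"
      using that by (intro grF I_in_Fo[OF w] I_in_W[OF w]) auto
    ultimately show ?thesis using gpmhs unfolding is_gpmhs_def by blast
  qed
  show ?thesis
  proof (cases "k < a + a'")
    case True then show ?thesis using high[OF u w k] by blast
  next
    case False
    then have "Q k (cnjv u) (cnjv w) = 0"
      using ne k by (intro high[OF cnjv_I[OF u] cnjv_I[OF w]]) auto
    then show ?thesis using Q_cnjv I_in_W[OF u] I_in_W[OF w] k by auto
  qed
qed

lemma Q_eq_Q_bcomp:
  assumes z: "z \<in> W k" and w: "w \<in> I p q" "p + q = k"
  shows "Q k z w = Q k (bcomp I z (q, p)) w"
proof -
  have vanish: "Q k (bcomp I z ab) w = 0" if "ab \<noteq> (q, p)" for ab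
  proof (cases "bcomp I z ab = 0")
    case False
    then have le: "fst ab + snd ab \<le> k" using weight_bcomp_le[OF z] by blast
    have wW: "w \<in> W k" using I_in_W w by auto
    show ?thesis
    proof (cases "fst ab + snd ab < k")
      case True
      then have "bcomp I z ab \<in> W (k - 1)" using I_in_W[OF bcomp_mem] by auto
      then show ?thesis using Q_lower[OF wW] by blast
    next
      case False
      then have "fst ab + p \<noteq> k" using le that w(2) by (cases ab) auto
      then show ?thesis using Q_I_orthogonal[OF bcomp_mem w(1)] le False w(2) by auto
    qed
  qed (simp add: cbilinear_zero_left[OF cbilinear_Q])
  have "Q k z w = (\<Sum>ab\<in>bsupp I. Q k (bcomp I z ab) w)"
    by (subst (1) sum_bcomp[of z, symmetric]) (rule cbilinear_sum_left[OF cbilinear_Q])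
  also have "\<dots> = Q k (bcomp I z (q, p)) w"
    using vanish by (intro sum_eq_single finite_bsupp) (auto simp: bcomp_outside cbilinear_zero_left[OF cbilinear_Q])
  finally show ?thesis .
qed

end

section \<open>The operator \<open>L\<close>\<close>

text \<open>The reason why \<open>L\<close> preserves reality only modulo \<open>W (k - 2)\<close>: this fails for \<open>r = s = -1\<close>.\<close>
lemma cnj_Lcoef: "-1 \<le> r + s \<Longrightarrow> r + s \<le> 0 \<Longrightarrow> cnj (Lcoef r s) = Lcoef s r"
  by (auto simp: Lcoef_def)

context split_gpmhs
begin

text \<open>An associative algebra cutting out \<open>hlie W Q\<close> from \<open>gClie W Q\<close> (\<open>hlie_eq\<close>); the gauge
  equation is solved inside it.\<close>
definition pres_W_real :: "(complex^'n^'n) set" where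
  "pres_W_real = {X \<in> stabilizer W. \<forall>k. \<forall>x\<in>W k. cnjv (X *v x) - X *v cnjv x \<in> W (k - 2)}"

lemma Lop_apply: "Lop I X *v v = (\<Sum>pq\<in>bsupp I. \<Sum>pq'\<in>bsupp I.
      Lcoef (fst pq' - fst pq) (snd pq' - snd pq) *s bcomp I (X *v bcomp I v pq) pq')"
proof -
  have "Vector_Spaces.linear (*s) (*s) (\<lambda>v. \<Sum>pq\<in>bsupp I. \<Sum>pq'\<in>bsupp I.
      Lcoef (fst pq' - fst pq) (snd pq' - snd pq) *s bcomp I (X *v bcomp I v pq) pq')"
    by unfold_locales
      (simp_all add: bcomp_add bcomp_scale matrix_vector_right_distrib vector_scalar_commute
        vec.scale_right_distrib sum.distrib vec.scale_sum_right mult.commute)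
  then show ?thesis unfolding Lop_def bproj_eq_bcomp by (simp add: matrix_works)
qed

lemma bcomp_Lop: "bcomp I (Lop I X *v v) (a, b) =
   (\<Sum>pq\<in>bsupp I. Lcoef (a - fst pq) (b - snd pq) *s bcomp I (X *v bcomp I v pq) (a, b))"
proof -
  have "bcomp I (Lop I X *v v) (a, b) = (\<Sum>pq\<in>bsupp I. \<Sum>pq'\<in>bsupp I.
      Lcoef (fst pq' - fst pq) (snd pq' - snd pq) *s bcomp I (bcomp I (X *v bcomp I v pq) pq') (a, b))"
    unfolding Lop_apply by (simp add: bcomp_sum bcomp_scale)
  also have "\<dots> = (\<Sum>pq\<in>bsupp I. Lcoef (a - fst pq) (b - snd pq) *s bcomp I (X *v bcomp I v pq) (a, b))"
    by (intro sum.cong refl, subst sum_eq_single[OF finite_bsupp, where z="(a, b)"])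
      (auto simp: bcomp_bcomp bcomp_outside)
  finally show ?thesis .
qed

lemma bcomp_Lop_single:
  assumes u: "u \<in> I p q"
  shows "bcomp I (Lop I X *v u) ab = Lcoef (fst ab - p) (snd ab - q) *s bcomp I (X *v u) ab"
proof -
  have "bcomp I (Lop I X *v u) ab =
      (\<Sum>pq\<in>bsupp I. Lcoef (fst ab - fst pq) (snd ab - snd pq) *s bcomp I (X *v bcomp I u pq) ab)"
    using bcomp_Lop[of X u "fst ab" "snd ab"] by simp
  also have "\<dots> = Lcoef (fst ab - p) (snd ab - q) *s bcomp I (X *v u) ab"
    using u by (subst sum_eq_single[OF finite_bsupp, where z="(p, q)"])
      (auto simp: bcomp_single[OF u] bcomp_zero bsupp_def)
  finally show ?thesis .
qed

lemma Lop_stabilizer_W: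
  assumes X: "X \<in> stabilizer W"
  shows "Lop I X \<in> stabilizer W"
  unfolding stabilizer_def mem_Collect_eq
proof (intro allI ballI)
  fix k v assume v: "v \<in> W k"
  have "bcomp I (X *v bcomp I v pq) (a, b) = 0" if "k < a + b" for pq a b
  proof (cases "bcomp I v pq = 0")
    case False
    then have le: "fst pq + snd pq \<le> k" using weight_bcomp_le v by blast
    have "bcomp I v pq \<in> W (fst pq + snd pq)" using I_in_W[OF bcomp_mem] by simp
    then have "X *v bcomp I v pq \<in> W (fst pq + snd pq)" using X unfolding stabilizer_def by blast
    then show ?thesis unfolding mem_W_iff using le that by auto
  qed (simp add: bcomp_zero)
  then show "Lop I X *v v \<in> W k"
    unfolding mem_W_iff bcomp_Lop by simp
qed

lemma cnjv_Lop_component: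
  assumes X: "X \<in> pres_W_real" and v: "v \<in> W k" and ab: "k - 2 < a + b"
  shows "cnj (Lcoef (b - fst pq) (a - snd pq)) *s cnjv (bcomp I (X *v bcomp I v pq) (b, a)) =
    Lcoef (a - snd pq) (b - fst pq) *s bcomp I (X *v cnjv (bcomp I v pq)) (a, b)"
proof (cases "bcomp I v pq = 0")
  case False
  define u where "u = bcomp I v pq"
  define m where "m = fst pq + snd pq"
  have mk: "m \<le> k" using weight_bcomp_le v False unfolding m_def by blast
  have "u \<in> W m" using I_in_W[OF bcomp_mem] unfolding u_def m_def by simp
  then have D: "cnjv (X *v u) - X *v cnjv u \<in> W (m - 2)" and XuW: "X *v u \<in> W m"
    using X unfolding pres_W_real_def stabilizer_def by blast+
  have "bcomp I (cnjv (X *v u) - X *v cnjv u) (a, b) = 0"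
    using D ab mk unfolding mem_W_iff by auto
  then have e: "bcomp I (X *v cnjv u) (a, b) = cnjv (bcomp I (X *v u) (b, a))"
    by (simp add: bcomp_diff bcomp_cnjv)
  show ?thesis
  proof (cases "bcomp I (X *v u) (b, a) = 0")
    case False
    then have "b + a \<le> m" using weight_bcomp_le[OF XuW, of "(b, a)"] by simp
    then have "cnj (Lcoef (b - fst pq) (a - snd pq)) = Lcoef (a - snd pq) (b - fst pq)"
      using ab mk unfolding m_def by (intro cnj_Lcoef) auto
    then show ?thesis using e unfolding u_def by simp
  qed (use e u_def in simp)
qed (simp add: bcomp_zero)

lemma Lop_pres_W_real:
  assumes X: "X \<in> pres_W_real"
  shows "Lop I X \<in> pres_W_real"
  unfolding pres_W_real_def mem_Collect_eq
proof (intro allI ballI conjI)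
  show "Lop I X \<in> stabilizer W" using Lop_stabilizer_W X unfolding pres_W_real_def by blast
  fix k v assume v: "v \<in> W k"
  show "cnjv (Lop I X *v v) - Lop I X *v cnjv v \<in> W (k - 2)"
    unfolding mem_W_iff
  proof (intro allI impI)
    fix a b assume ab: "k - 2 < a + b"
    have L: "bcomp I (cnjv (Lop I X *v v)) (a, b) = (\<Sum>pq\<in>bsupp I.
       cnj (Lcoef (b - fst pq) (a - snd pq)) *s cnjv (bcomp I (X *v bcomp I v pq) (b, a)))"
      by (simp add: bcomp_cnjv bcomp_Lop cnjv_sum)
    have "bcomp I (Lop I X *v cnjv v) (a, b) = (\<Sum>pq\<in>bsupp I.
       Lcoef (a - fst pq) (b - snd pq) *s bcomp I (X *v cnjv (bcomp I v (prod.swap pq))) (a, b))"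
      unfolding bcomp_Lop by (simp add: bcomp_cnjv)
    also have "\<dots> = (\<Sum>pq\<in>prod.swap ` bsupp I.
       Lcoef (a - snd pq) (b - fst pq) *s bcomp I (X *v cnjv (bcomp I v pq)) (a, b))"
      by (subst sum.reindex) (auto simp: o_def)
    finally have R: "bcomp I (Lop I X *v cnjv v) (a, b) = (\<Sum>pq\<in>bsupp I.
       Lcoef (a - snd pq) (b - fst pq) *s bcomp I (X *v cnjv (bcomp I v pq)) (a, b))"
      by (simp add: swap_image_bsupp)
    have "bcomp I (cnjv (Lop I X *v v)) (a, b) = bcomp I (Lop I X *v cnjv v) (a, b)"
      unfolding L R using cnjv_Lop_component[OF X v ab] by simp
    then show "bcomp I (cnjv (Lop I X *v v) - Lop I X *v cnjv v) (a, b) = 0"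
      by (simp add: bcomp_diff)
  qed
qed

lemma Q_Lop_left:
  assumes X: "X \<in> stabilizer W" and u: "u \<in> I p0 q0" "p0 + q0 = k" and w: "w \<in> I p1 q1" "p1 + q1 = k"
  shows "Q k (Lop I X *v u) w = Lcoef (q1 - p0) (p1 - q0) * Q k (X *v u) w"
proof -
  have XuW: "X *v u \<in> W k" and LXuW: "Lop I X *v u \<in> W k"
    using X Lop_stabilizer_W[OF X] I_in_W[OF u(1)] u(2) unfolding stabilizer_def by auto
  have "Q k (Lop I X *v u) w = Q k (bcomp I (Lop I X *v u) (q1, p1)) w"
    by (rule Q_eq_Q_bcomp[OF LXuW w])
  also have "\<dots> = Lcoef (q1 - p0) (p1 - q0) * Q k (bcomp I (X *v u) (q1, p1)) w"
    by (simp add: bcomp_Lop_single[OF u(1)] cbilinear_scale_left[OF cbilinear_Q])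
  also have "\<dots> = Lcoef (q1 - p0) (p1 - q0) * Q k (X *v u) w"
    using Q_eq_Q_bcomp[OF XuW w] by simp
  finally show ?thesis .
qed

lemma Q_Lop_right:
  assumes X: "X \<in> stabilizer W" and u: "u \<in> I p0 q0" "p0 + q0 = k" and w: "w \<in> I p1 q1" "p1 + q1 = k"
  shows "Q k u (Lop I X *v w) = Lcoef (q0 - p1) (p0 - q1) * Q k u (X *v w)"
proof -
  have uW: "u \<in> W k" and XwW: "X *v w \<in> W k" and LXwW: "Lop I X *v w \<in> W k"
    using X Lop_stabilizer_W[OF X] I_in_W u w unfolding stabilizer_def by auto
  show ?thesis
    unfolding Q_sym[OF LXwW uW] Q_sym[OF XwW uW] Q_Lop_left[OF X w u] by (simp add: mult_ac)
qed

lemma Q_Lop_pair: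
  assumes X: "X \<in> gClie W Q"
    and u: "u \<in> I p0 q0" "p0 + q0 \<le> k" and w: "w \<in> I p1 q1" "p1 + q1 \<le> k"
  shows "Q k (Lop I X *v u) w + Q k u (Lop I X *v w) = 0"
proof (cases "p0 + q0 = k \<and> p1 + q1 = k")
  case True
  have XW: "X \<in> stabilizer W" using X unfolding gClie_def stabilizer_def by blast
  from True have e: "q0 - p1 = q1 - p0" "p0 - q1 = p1 - q0" by auto
  have "Q k (X *v u) w + Q k u (X *v w) = 0"
    using X I_in_W u w unfolding gClie_def by blast
  then show ?thesis
    unfolding Q_Lop_left[OF XW u(1) _ w(1), OF conjunct1[OF True] conjunct2[OF True]]
      Q_Lop_right[OF XW u(1) _ w(1), OF conjunct1[OF True] conjunct2[OF True]] e
    by (simp add: distrib_left[symmetric])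
next
  case False
  have LW: "Lop I X \<in> stabilizer W"
    using X Lop_stabilizer_W unfolding gClie_def stabilizer_def by blast
  have uW: "u \<in> W k" and wW: "w \<in> W k" using I_in_W u w by auto
  then have LuW: "Lop I X *v u \<in> W k" and LwW: "Lop I X *v w \<in> W k"
    using LW unfolding stabilizer_def by auto
  from False have "u \<in> W (k - 1) \<or> w \<in> W (k - 1)" using u w by (auto intro: I_in_W)
  then show ?thesis
  proof
    assume u1: "u \<in> W (k - 1)"
    then have "Lop I X *v u \<in> W (k - 1)" using LW unfolding stabilizer_def by blast
    then show ?thesis using Q_lower[OF wW] Q_lower[OF LwW u1] by simp
  next
    assume w1: "w \<in> W (k - 1)"
    then have "Lop I X *v w \<in> W (k - 1)" using LW unfolding stabilizer_def by blast
    then show ?thesis using Q_lower[OF uW] Q_lower[OF LuW w1] by simp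
  qed
qed

lemma Lop_gClie:
  assumes X: "X \<in> gClie W Q"
  shows "Lop I X \<in> gClie W Q"
proof -
  have LW: "Lop I X \<in> stabilizer W"
    using X Lop_stabilizer_W unfolding gClie_def stabilizer_def by blast
  have "Q k (Lop I X *v x) y + Q k x (Lop I X *v y) = 0" if x: "x \<in> W k" and y: "y \<in> W k" for k x y
  proof -
    have decomp: "Q k (Lop I X *v x) y = Q k (Lop I X *v (\<Sum>pq\<in>bsupp I. bcomp I x pq)) (\<Sum>pq'\<in>bsupp I. bcomp I y pq')"
        "Q k x (Lop I X *v y) = Q k (\<Sum>pq\<in>bsupp I. bcomp I x pq) (Lop I X *v (\<Sum>pq'\<in>bsupp I. bcomp I y pq'))"
      by (simp_all add: sum_bcomp)
    have "Q k (Lop I X *v x) y = (\<Sum>pq\<in>bsupp I. \<Sum>pq'\<in>bsupp I. Q k (Lop I X *v bcomp I x pq) (bcomp I y pq'))"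
      unfolding decomp
      by (simp add: matrix_vector_mult_sum cbilinear_sum_left[OF cbilinear_Q] cbilinear_sum_right[OF cbilinear_Q])
        (rule sum.swap)
    moreover have "Q k x (Lop I X *v y) = (\<Sum>pq\<in>bsupp I. \<Sum>pq'\<in>bsupp I. Q k (bcomp I x pq) (Lop I X *v bcomp I y pq'))"
      unfolding decomp
      by (simp add: matrix_vector_mult_sum cbilinear_sum_left[OF cbilinear_Q] cbilinear_sum_right[OF cbilinear_Q])
        (rule sum.swap)
    ultimately have "Q k (Lop I X *v x) y + Q k x (Lop I X *v y) = (\<Sum>pq\<in>bsupp I. \<Sum>pq'\<in>bsupp I.
        Q k (Lop I X *v bcomp I x pq) (bcomp I y pq') + Q k (bcomp I x pq) (Lop I X *v bcomp I y pq'))"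
      by (simp add: sum.distrib)
    also have "\<dots> = 0"
    proof (intro sum.neutral ballI)
      fix pq pq'
      show "Q k (Lop I X *v bcomp I x pq) (bcomp I y pq') + Q k (bcomp I x pq) (Lop I X *v bcomp I y pq') = 0"
      proof (cases "bcomp I x pq = 0 \<or> bcomp I y pq' = 0")
        case False
        then have "fst pq + snd pq \<le> k" "fst pq' + snd pq' \<le> k" using weight_bcomp_le x y by blast+
        then show ?thesis using Q_Lop_pair[OF X bcomp_mem _ bcomp_mem] by blast
      qed (auto simp: cbilinear_zero_left[OF cbilinear_Q] cbilinear_zero_right[OF cbilinear_Q])
    qed
    finally show ?thesis .
  qed
  then show ?thesis using LW unfolding gClie_def stabilizer_def by blast
qed

lemma hlie_eq: "hlie W Q = gClie W Q \<inter> pres_W_real"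
  unfolding hlie_def gClie_def pres_W_real_def stabilizer_def by blast

lemma Lop_hlie: "X \<in> hlie W Q \<Longrightarrow> Lop I X \<in> hlie W Q"
  unfolding hlie_eq using Lop_gClie Lop_pres_W_real by blast

text \<open>On the components lowering the Hodge degree \<open>p\<close>, \<open>L\<close> acts as \<open>-\<i>\<close>, so these cancel in \<open>\<i> X + L X\<close>.\<close>
lemma i_plus_Lop_stabilizer_Fo: "cscaleM \<i> X + Lop I X \<in> stabilizer Fo"
  unfolding stabilizer_def mem_Collect_eq
proof (intro allI ballI)
  fix p x assume x: "x \<in> Fo p"
  have "bcomp I ((cscaleM \<i> X + Lop I X) *v x) (a, b) = 0" if ab: "a < p" for a b
  proof -
    have e: "bcomp I (X *v x) (a, b) = (\<Sum>pq\<in>bsupp I. bcomp I (X *v bcomp I x pq) (a, b))"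
      by (subst (1) sum_bcomp[of x, symmetric]) (simp add: matrix_vector_mult_sum bcomp_sum)
    have "bcomp I ((cscaleM \<i> X + Lop I X) *v x) (a, b) =
      (\<Sum>pq\<in>bsupp I. (\<i> + Lcoef (a - fst pq) (b - snd pq)) *s bcomp I (X *v bcomp I x pq) (a, b))"
      by (simp add: matrix_vector_mult_add_rdistrib cscaleM_matrix_vector_mult bcomp_add bcomp_scale
          e bcomp_Lop vec.scale_sum_right sum.distrib vec.scale_left_distrib)
    also have "\<dots> = 0"
    proof (intro sum.neutral ballI)
      fix pq
      show "(\<i> + Lcoef (a - fst pq) (b - snd pq)) *s bcomp I (X *v bcomp I x pq) (a, b) = 0"
      proof (cases "bcomp I x pq = 0")
        case False
        then have "p \<le> fst pq" using x unfolding mem_Fo_iff by (cases pq) (auto simp: not_le[symmetric])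
        then show ?thesis using ab by (simp add: Lcoef_def)
      qed (simp add: bcomp_zero)
    qed
    finally show ?thesis .
  qed
  then show "(cscaleM \<i> X + Lop I X) *v x \<in> Fo p" unfolding mem_Fo_iff by blast
qed

lemma bounded_linear_Lop: "bounded_linear (Lop I)"
proof -
  have "linear (Lop I)"
    by (rule linearI)
      (simp_all add: matrix_eq Lop_apply matrix_vector_mult_add_rdistrib matrix_vector_mult_scaleR
        bcomp_add bcomp_scale vec.scale_right_distrib vec.scale_sum_right sum.distrib mult.commute)
  then show ?thesis by (simp add: linear_conv_bounded_linear)
qed

lemma subspace_pres_W_real: "subspace pres_W_real"
  unfolding subspace_def pres_W_real_def
proof (intro conjI ballI allI)
  show "0 \<in> {X \<in> stabilizer W. \<forall>k. \<forall>x\<in>W k. cnjv (X *v x) - X *v cnjv x \<in> W (k - 2)}"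
    using subspace_0[OF subspace_stabilizer[OF subspace_W]] by (simp add: vec.subspace_0[OF subspace_W])
  fix X Y c assume X: "X \<in> {X \<in> stabilizer W. \<forall>k. \<forall>x\<in>W k. cnjv (X *v x) - X *v cnjv x \<in> W (k - 2)}"
    and Y: "Y \<in> {X \<in> stabilizer W. \<forall>k. \<forall>x\<in>W k. cnjv (X *v x) - X *v cnjv x \<in> W (k - 2)}"
  have "cnjv ((X + Y) *v x) - (X + Y) *v cnjv x =
      (cnjv (X *v x) - X *v cnjv x) + (cnjv (Y *v x) - Y *v cnjv x)" for x
    by (simp add: algebra_simps)
  then show "X + Y \<in> {X \<in> stabilizer W. \<forall>k. \<forall>x\<in>W k. cnjv (X *v x) - X *v cnjv x \<in> W (k - 2)}"
    using X Y subspace_add[OF subspace_stabilizer[OF subspace_W]] by (auto intro: vec.subspace_add[OF subspace_W])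
  have "cnjv ((c *\<^sub>R X) *v x) - (c *\<^sub>R X) *v cnjv x = c *\<^sub>R (cnjv (X *v x) - X *v cnjv x)" for x
    by (simp add: matrix_vector_mult_scaleR scaleR_vec_complex algebra_simps)
  then show "c *\<^sub>R X \<in> {X \<in> stabilizer W. \<forall>k. \<forall>x\<in>W k. cnjv (X *v x) - X *v cnjv x \<in> W (k - 2)}"
    using X subspace_mul[OF subspace_stabilizer[OF subspace_W]]
    by (auto intro: subspace_mul[OF vec_subspace_imp_subspace[OF subspace_W]])
qed

lemma pres_W_real_mult:
  assumes X: "X \<in> pres_W_real" and Y: "Y \<in> pres_W_real" shows "X ** Y \<in> pres_W_real"
  unfolding pres_W_real_def mem_Collect_eq
proof (intro allI ballI conjI)
  show "X ** Y \<in> stabilizer W" using X Y stabilizer_mult unfolding pres_W_real_def by blast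
  fix k x assume x: "x \<in> W k"
  have Yx: "Y *v x \<in> W k" using Y x unfolding pres_W_real_def stabilizer_def by blast
  have "cnjv (X *v (Y *v x)) - X *v cnjv (Y *v x) \<in> W (k - 2)"
    using X Yx unfolding pres_W_real_def by blast
  moreover have "X *v (cnjv (Y *v x) - Y *v cnjv x) \<in> W (k - 2)"
    using X Y x unfolding pres_W_real_def stabilizer_def by blast
  moreover have "cnjv ((X ** Y) *v x) - (X ** Y) *v cnjv x =
     (cnjv (X *v (Y *v x)) - X *v cnjv (Y *v x)) + X *v (cnjv (Y *v x) - Y *v cnjv x)"
    by (simp add: matrix_vector_mul_assoc[symmetric] matrix_vector_mult_diff_distrib)
  ultimately show "cnjv ((X ** Y) *v x) - (X ** Y) *v cnjv x \<in> W (k - 2)"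
    by (simp add: vec.subspace_add[OF subspace_W])
qed

lemma mat_1_pres_W_real: "mat 1 \<in> pres_W_real"
  unfolding pres_W_real_def using mat_1_stabilizer by (simp add: vec.subspace_0[OF subspace_W])

lemma gClie_cscaleM:
  assumes X: "X \<in> gClie W Q" shows "cscaleM c X \<in> gClie W Q"
  unfolding gClie_def mem_Collect_eq
proof (intro allI conjI ballI)
  fix k x assume x: "x \<in> W k"
  show "cscaleM c X *v x \<in> W k" using X x unfolding cscaleM_matrix_vector_mult gClie_def
    by (auto intro: vec.subspace_scale[OF subspace_W])
  fix y assume y: "y \<in> W k"
  have "Q k (X *v x) y + Q k x (X *v y) = 0" using X x y unfolding gClie_def by blast
  then show "Q k (cscaleM c X *v x) y + Q k x (cscaleM c X *v y) = 0"
    unfolding cscaleM_matrix_vector_mult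
    by (simp add: cbilinear_scale_left[OF cbilinear_Q] cbilinear_scale_right[OF cbilinear_Q] distrib_left[symmetric])
qed

end

section \<open>Linear differential equations\<close>

lemma integral_in_subspace:
  fixes f :: "real \<Rightarrow> 'a::euclidean_space"
  assumes S: "subspace S" and f: "f integrable_on {c..y}" and fS: "\<And>s. s \<in> {c..y} \<Longrightarrow> f s \<in> S"
  shows "integral {c..y} f \<in> S"
proof -
  obtain u z where u: "u \<in> span S" and z: "\<And>w. w \<in> span S \<Longrightarrow> orthogonal z w"
    and e: "integral {c..y} f = u + z"
    using orthogonal_subspace_decomp_exists[of S "integral {c..y} f"] by blast
  have "z \<bullet> integral {c..y} f = integral {c..y} (\<lambda>s. z \<bullet> f s)"
    using integral_linear[OF f bounded_linear_inner_right[of z]] by (simp add: o_def)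
  also have "\<dots> = integral {c..y} (\<lambda>s. 0)"
    by (rule integral_cong) (use z fS span_superset[of S] in \<open>auto simp: orthogonal_def\<close>)
  finally have "z \<bullet> z = 0"
    using e z[OF u] by (simp add: inner_add_right orthogonal_def)
  then show ?thesis using e u span_eq_iff[THEN iffD2, OF S] by simp
qed

lemma has_integral_power_shifted:
  fixes c y :: real
  assumes "c \<le> y"
  shows "((\<lambda>s. (s - c) ^ n) has_integral (y - c) ^ Suc n / Suc n) {c..y}"
proof -
  have "((\<lambda>s. (s - c) ^ Suc n / Suc n) has_real_derivative (Suc n * (s - c) ^ n) / Suc n)
      (at s within {c..y})" for s
    by (rule derivative_eq_intros refl)+ (simp_all add: field_simps del: of_nat_Suc)
  then have "((\<lambda>s. (s - c) ^ Suc n / Suc n) has_real_derivative (s - c) ^ n) (at s within {c..y})" for s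
    by (simp del: of_nat_Suc)
  from fundamental_theorem_of_calculus[OF assms, of "\<lambda>s. (s - c) ^ Suc n / Suc n", OF this[unfolded has_real_derivative_iff_has_vector_derivative]]
  show ?thesis by simp
qed

lemma fact_power_identity:
  fixes C L t :: real
  shows "C * L ^ Suc n / fact n * (t ^ Suc n / Suc n) = C * (L * t) ^ Suc n / fact (Suc n)"
  by (simp add: field_simps del: of_nat_Suc)

primrec picard :: "('a::euclidean_space \<Rightarrow> 'b \<Rightarrow> 'a) \<Rightarrow> (real \<Rightarrow> 'b) \<Rightarrow> real \<Rightarrow> 'a \<Rightarrow> nat \<Rightarrow> real \<Rightarrow> 'a" where
  "picard bil B c u0 0 = (\<lambda>_. u0)"
| "picard bil B c u0 (Suc n) = (\<lambda>y. u0 + integral {c..y} (\<lambda>s. bil (picard bil B c u0 n s) (B s)))"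

text \<open>Written as a telescoping series, the limit does not depend on the interval on which the
  iterates converge.\<close>
definition picard_limit :: "('a::euclidean_space \<Rightarrow> 'b \<Rightarrow> 'a) \<Rightarrow> (real \<Rightarrow> 'b) \<Rightarrow> real \<Rightarrow> 'a \<Rightarrow> real \<Rightarrow> 'a" where
  "picard_limit bil B c u0 y = u0 + (\<Sum>n. picard bil B c u0 (Suc n) y - picard bil B c u0 n y)"

locale picard_interval =
  fixes bil :: "'a::euclidean_space \<Rightarrow> 'b::real_normed_vector \<Rightarrow> 'a" and B :: "real \<Rightarrow> 'b"
    and c d :: real and u0 :: 'a
  assumes bounded_bilinear: "bounded_bilinear bil"
    and continuous_B: "continuous_on {c..d} B"
begin

sublocale bil: bounded_bilinear bil by (rule bounded_bilinear)

abbreviation "P \<equiv> picard bil B c u0"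
abbreviation "U \<equiv> picard_limit bil B c u0"

lemma continuous_on_picard: "continuous_on {c..d} (P n)"
proof (induction n)
  case (Suc n)
  have "(\<lambda>s. bil (P n s) (B s)) integrable_on {c..d}"
    by (intro integrable_continuous_real bil.continuous_on Suc continuous_B)
  then show ?case by (simp add: continuous_on_add indefinite_integral_continuous_1)
qed simp

lemma integrable_bil_B:
  assumes "continuous_on {c..d} g" "y \<le> d"
  shows "(\<lambda>s. bil (g s) (B s)) integrable_on {c..y}"
proof -
  have "{c..y} \<subseteq> {c..d}" using assms(2) by auto
  then show ?thesis
    by (intro integrable_continuous_real bil.continuous_on continuous_on_subset[OF assms(1)]
        continuous_on_subset[OF continuous_B])
qed

lemma bil_B_bound:
  obtains L where "L \<ge> 0" "\<And>x s. s \<in> {c..d} \<Longrightarrow> norm (bil x (B s)) \<le> L * norm x"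
proof -
  obtain K where K: "K > 0" "\<And>a b. norm (bil a b) \<le> norm a * norm b * K"
    using bil.pos_bounded by blast
  obtain M where M: "M > 0" "\<And>s. s \<in> {c..d} \<Longrightarrow> norm (B s) \<le> M"
    using compact_imp_bounded[OF compact_continuous_image[OF continuous_B compact_Icc]]
    unfolding bounded_pos by auto
  have "norm (bil x (B s)) \<le> K * M * norm x" if "s \<in> {c..d}" for x s
  proof -
    have "norm (bil x (B s)) \<le> norm x * norm (B s) * K" by (rule K(2))
    also have "\<dots> \<le> norm x * M * K" using M(2)[OF that] K(1) by (intro mult_right_mono mult_left_mono) auto
    finally show ?thesis by (simp add: mult_ac)
  qed
  then show ?thesis using that[of "K * M"] K(1) M(1) by simp
qed

lemma norm_integral_bil_le:
  assumes L: "L \<ge> 0" "\<And>x s. s \<in> {c..d} \<Longrightarrow> norm (bil x (B s)) \<le> L * norm x"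
    and g: "continuous_on {c..d} g" "\<And>s. s \<in> {c..y} \<Longrightarrow> norm (g s) \<le> C * (L * (s - c)) ^ n / fact n"
    and y: "y \<in> {c..d}"
  shows "norm (integral {c..y} (\<lambda>s. bil (g s) (B s))) \<le> C * (L * (y - c)) ^ Suc n / fact (Suc n)"
proof -
  have "((\<lambda>s. C * L ^ Suc n / fact n * (s - c) ^ n) has_integral
      C * L ^ Suc n / fact n * ((y - c) ^ Suc n / Suc n)) {c..y}"
    using y by (intro has_integral_mult_right has_integral_power_shifted) auto
  moreover have "norm (bil (g s) (B s)) \<le> C * L ^ Suc n / fact n * (s - c) ^ n" if s: "s \<in> {c..y}" for s
  proof -
    have "norm (bil (g s) (B s)) \<le> L * norm (g s)" using L(2) s y by simp
    also have "\<dots> \<le> L * (C * (L * (s - c)) ^ n / fact n)" using g(2)[OF s] L(1) by (rule mult_left_mono)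
    finally show ?thesis by (simp add: power_mult_distrib mult_ac)
  qed
  ultimately have "norm (integral {c..y} (\<lambda>s. bil (g s) (B s))) \<le> C * L ^ Suc n / fact n * ((y - c) ^ Suc n / Suc n)"
    using integrable_bil_B[OF g(1)] y
    by (metis (no_types, lifting) has_integral_integrable integral_norm_bound_integral integral_unique atLeastAtMost_iff)
  also have "\<dots> = C * (L * (y - c)) ^ Suc n / fact (Suc n)"
    by (rule fact_power_identity)
  finally show ?thesis .
qed

lemma picard_step_bound:
  obtains L where "L \<ge> 0"
    "\<And>n y. y \<in> {c..d} \<Longrightarrow> norm (P (Suc n) y - P n y) \<le> norm u0 * (L * (y - c)) ^ Suc n / fact (Suc n)"
proof -
  obtain L where L: "L \<ge> 0" "\<And>x s. s \<in> {c..d} \<Longrightarrow> norm (bil x (B s)) \<le> L * norm x"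
    using bil_B_bound by metis
  have "norm (P (Suc n) y - P n y) \<le> norm u0 * (L * (y - c)) ^ Suc n / fact (Suc n)" if "y \<in> {c..d}" for n y
    using that
  proof (induction n arbitrary: y)
    case 0
    show ?case using norm_integral_bil_le[OF L, where g="\<lambda>_. u0" and C="norm u0" and n=0 and y=y] 0 by auto
  next
    case (Suc n)
    have "P (Suc (Suc n)) y - P (Suc n) y =
        integral {c..y} (\<lambda>s. bil (P (Suc n) s) (B s)) - integral {c..y} (\<lambda>s. bil (P n s) (B s))"
      by (simp only: picard.simps) simp
    also have "\<dots> = integral {c..y} (\<lambda>s. bil (P (Suc n) s) (B s) - bil (P n s) (B s))"
      using Suc.prems by (intro integral_diff[symmetric] integrable_bil_B continuous_on_picard) auto
    finally have eq: "P (Suc (Suc n)) y - P (Suc n) y = integral {c..y} (\<lambda>s. bil (P (Suc n) s - P n s) (B s))"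
      by (simp only: bil.diff_left)
    have "continuous_on {c..d} (\<lambda>s. P (Suc n) s - P n s)"
      by (intro continuous_on_diff continuous_on_picard)
    from norm_integral_bil_le[OF L this _ Suc.prems, where C="norm u0" and n="Suc n"] Suc.IH Suc.prems
    show ?case unfolding eq by (auto simp del: picard.simps)
  qed
  with L(1) that show ?thesis by blast
qed

lemma uniform_limit_picard: "uniform_limit {c..d} P U sequentially"
proof -
  obtain L where L: "L \<ge> 0"
    "\<And>n y. y \<in> {c..d} \<Longrightarrow> norm (P (Suc n) y - P n y) \<le> norm u0 * (L * (y - c)) ^ Suc n / fact (Suc n)"
    using picard_step_bound by blast
  define Mn where "Mn n = norm u0 * (L * (d - c)) ^ Suc n / fact (Suc n)" for n
  have bound: "norm (P (Suc n) y - P n y) \<le> Mn n" if y: "y \<in> {c..d}" for n y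
  proof -
    have "(L * (y - c)) ^ Suc n \<le> (L * (d - c)) ^ Suc n"
      using y L(1) by (intro power_mono mult_left_mono) auto
    then show ?thesis
      unfolding Mn_def by (intro order_trans[OF L(2)[OF y]] divide_right_mono mult_left_mono) auto
  qed
  have "summable (\<lambda>n. (L * (d - c)) ^ Suc n / fact (Suc n))"
    using summable_exp[of "L * (d - c)"] by (subst summable_Suc_iff) (simp add: divide_inverse mult.commute)
  from summable_mult[OF this, of "norm u0"] have sM: "summable Mn"
    unfolding Mn_def by (simp only: times_divide_eq_right)
  have "uniform_limit {c..d} (\<lambda>n y. \<Sum>i<n. P (Suc i) y - P i y) (\<lambda>y. \<Sum>i. P (Suc i) y - P i y) sequentially"
    by (rule Weierstrass_m_test[where f="\<lambda>i y. P (Suc i) y - P i y", OF bound sM])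
  then have "uniform_limit {c..d} (\<lambda>n y. u0 + (\<Sum>i<n. P (Suc i) y - P i y)) U sequentially"
    unfolding picard_limit_def by (intro uniform_limit_intros)
  moreover have "u0 + (\<Sum>i<n. P (Suc i) y - P i y) = P n y" for n y
    using sum_lessThan_telescope[of "\<lambda>i. P i y" n] by (simp del: picard.simps(2))
  ultimately show ?thesis by simp
qed

lemma continuous_on_picard_limit: "continuous_on {c..d} U"
  by (rule uniform_limit_theorem[OF always_eventually[OF allI[OF continuous_on_picard]] uniform_limit_picard]) simp

lemma picard_limit_integral_eq:
  assumes y: "y \<in> {c..d}"
  shows "U y = u0 + integral {c..y} (\<lambda>s. bil (U s) (B s))"
proof -
  have "uniform_limit {c..y} P U sequentially"
    using y by (intro uniform_limit_on_subset[OF uniform_limit_picard]) auto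
  moreover have "bounded (B ` {c..y})" "bounded (U ` {c..y})"
    using y by (auto intro!: compact_imp_bounded compact_continuous_image
        continuous_on_subset[OF continuous_B] continuous_on_subset[OF continuous_on_picard_limit])
  ultimately have "uniform_limit {c..y} (\<lambda>n s. bil (P n s) (B s)) (\<lambda>s. bil (U s) (B s)) sequentially"
    by (intro bil.bounded_uniform_limit uniform_limit_const)
  then obtain Iv J where I: "\<And>n. ((\<lambda>s. bil (P n s) (B s)) has_integral Iv n) {c..y}"
    and J: "((\<lambda>s. bil (U s) (B s)) has_integral J) {c..y}" and lim: "Iv \<longlonglongrightarrow> J"
    using y by (elim uniform_limit_integral)
      (auto intro!: bil.continuous_on continuous_on_subset[OF continuous_on_picard] continuous_on_subset[OF continuous_B])
  have "(\<lambda>n. P (Suc n) y) \<longlonglongrightarrow> u0 + J"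
    using integral_unique[OF I] tendsto_add[OF tendsto_const lim] by simp
  moreover have "(\<lambda>n. P (Suc n) y) \<longlonglongrightarrow> U y"
    by (rule LIMSEQ_Suc[OF tendsto_uniform_limitI[OF uniform_limit_picard y]])
  ultimately show ?thesis using LIMSEQ_unique integral_unique[OF J] by blast
qed

lemma picard_limit_has_vector_derivative:
  assumes y: "y \<in> {c..d}"
  shows "(U has_vector_derivative bil (U y) (B y)) (at y within {c..d})"
proof -
  have "continuous_on {c..d} (\<lambda>s. bil (U s) (B s))"
    by (rule bil.continuous_on[OF continuous_on_picard_limit continuous_B])
  then have "((\<lambda>y. u0 + integral {c..y} (\<lambda>s. bil (U s) (B s))) has_vector_derivative bil (U y) (B y))
      (at y within {c..d})"
    using has_vector_derivative_const has_vector_derivative_add integral_has_vector_derivative[OF _ y]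
    by fastforce
  then show ?thesis
    by (rule has_vector_derivative_transform[OF y, rotated]) (simp add: picard_limit_integral_eq)
qed

lemma picard_limit_in_subspace:
  assumes S: "subspace S" "u0 \<in> S" "\<And>x s. x \<in> S \<Longrightarrow> s \<in> {c..d} \<Longrightarrow> bil x (B s) \<in> S"
    and y: "y \<in> {c..d}"
  shows "U y \<in> S"
proof -
  have "P n s \<in> S" if "s \<in> {c..d}" for n s
    using that
  proof (induction n arbitrary: s)
    case (Suc n)
    have "integral {c..s} (\<lambda>t. bil (P n t) (B t)) \<in> S"
      using Suc by (intro integral_in_subspace[OF S(1)] integrable_bil_B continuous_on_picard S(3)) auto
    then show ?case by (simp add: subspace_add[OF S(1) S(2)])
  qed (simp add: S(2))
  then show ?thesis
    using closed_sequentially[OF closed_subspace[OF S(1)] _ tendsto_uniform_limitI[OF uniform_limit_picard y]] y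
    by blast
qed

end

lemma picard_at_start: "picard bil B c u0 n c = u0"
  by (cases n) simp_all

lemma picard_limit_at_start: "picard_limit bil B c u0 c = u0"
  by (simp add: picard_limit_def picard_at_start)

lemma linear_ode_exists_right:
  fixes bil :: "'a::euclidean_space \<Rightarrow> 'b::real_normed_vector \<Rightarrow> 'a"
  assumes bil: "bounded_bilinear bil"
    and D: "is_interval D" "c \<in> D" "\<And>y. y \<in> D \<Longrightarrow> c \<le> y" "\<And>y. y \<in> D \<Longrightarrow> \<exists>d\<in>D. y < d"
    and B: "continuous_on D B"
    and S: "subspace S" "u0 \<in> S" "\<And>x y. x \<in> S \<Longrightarrow> y \<in> D \<Longrightarrow> bil x (B y) \<in> S"
  shows "\<exists>u. u c = u0 \<and> (\<forall>y\<in>D. u y \<in> S \<and> (u has_vector_derivative bil (u y) (B y)) (at y within D))"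
proof (intro exI[of _ "picard_limit bil B c u0"] conjI ballI)
  let ?U = "picard_limit bil B c u0"
  show "?U c = u0" by (rule picard_limit_at_start)
  fix y assume y: "y \<in> D"
  obtain d where d: "d \<in> D" "y < d" using D(4)[OF y] by blast
  have sub: "{c..d} \<subseteq> D"
    using D(1)[unfolded is_interval_1, rule_format, OF D(2) d(1)] by auto
  interpret picard_interval bil B c d u0
    by (rule picard_interval.intro[OF bil continuous_on_subset[OF B sub]])
  have yi: "y \<in> {c..d}" using D(3)[OF y] d by simp
  show "?U y \<in> S" by (rule picard_limit_in_subspace[OF S(1,2) _ yi]) (use sub in \<open>auto intro: S(3)\<close>)
  have "at y within D = at y within {c..d}"
  proof (rule at_within_nhd[where S="{..<d}"])
    show "D \<inter> {..<d} - {y} = {c..d} \<inter> {..<d} - {y}" using sub D(3) by auto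
  qed (use d in auto)
  then show "(?U has_vector_derivative bil (?U y) (B y)) (at y within D)"
    using picard_limit_has_vector_derivative[OF yi] by simp
qed

lemma linear_ode_exists_left:
  fixes bil :: "'a::euclidean_space \<Rightarrow> 'b::real_normed_vector \<Rightarrow> 'a"
  assumes bil: "bounded_bilinear bil" and y0: "a < y0"
    and B: "continuous_on {a<..y0} B"
    and S: "subspace S" "u0 \<in> S" "\<And>x y. x \<in> S \<Longrightarrow> y \<in> {a<..y0} \<Longrightarrow> bil x (B y) \<in> S"
  shows "\<exists>u. u y0 = u0 \<and>
    (\<forall>y\<in>{a<..y0}. u y \<in> S \<and> (u has_vector_derivative bil (u y) (B y)) (at y within {a<..y0}))"
proof -
  interpret bil: bounded_bilinear bil by (rule bil)
  have refl: "(\<lambda>y. y0 - y) ` {a<..y0} = {0..<y0 - a}"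
  proof
    show "{0..<y0 - a} \<subseteq> (\<lambda>y. y0 - y) ` {a<..y0}"
    proof
      fix t assume "t \<in> {0..<y0 - a}"
      then show "t \<in> (\<lambda>y. y0 - y) ` {a<..y0}" by (intro image_eqI[of _ _ "y0 - t"]) auto
    qed
  qed auto
  have "\<exists>v. v 0 = u0 \<and> (\<forall>t\<in>{0..<y0 - a}. v t \<in> S \<and>
      (v has_vector_derivative bil (v t) (- B (y0 - t))) (at t within {0..<y0 - a}))"
  proof (rule linear_ode_exists_right[OF bil])
    show "is_interval {0..<y0 - a}" by (simp add: is_interval_1)
    show "\<exists>d\<in>{0..<y0 - a}. t < d" if "t \<in> {0..<y0 - a}" for t
      using that by (intro bexI[of _ "(t + y0 - a) / 2"]) auto
    have "continuous_on {0..<y0 - a} (\<lambda>t. y0 - t)" by (intro continuous_on_diff continuous_on_const continuous_on_id)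
    then show "continuous_on {0..<y0 - a} (\<lambda>t. - B (y0 - t))"
      by (intro continuous_on_minus continuous_on_compose2[OF B]) auto
    show "bil x (- B (y0 - t)) \<in> S" if "x \<in> S" "t \<in> {0..<y0 - a}" for x t
      using S(3)[OF that(1)] that(2) subspace_neg[OF S(1)] by (auto simp: bil.minus_right)
  qed (use y0 S in auto)
  then obtain v where v0: "v 0 = u0" and v: "\<And>t. t \<in> {0..<y0 - a} \<Longrightarrow> v t \<in> S \<and>
      (v has_vector_derivative bil (v t) (- B (y0 - t))) (at t within {0..<y0 - a})"
    by blast
  have "((\<lambda>y. v (y0 - y)) has_vector_derivative bil (v (y0 - y)) (B y)) (at y within {a<..y0})"
    if y: "y \<in> {a<..y0}" for y
  proof -
    have d1: "((\<lambda>y. y0 - y) has_vector_derivative -1) (at y within {a<..y0})"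
      by (auto intro!: derivative_eq_intros)
    have d2: "(v has_vector_derivative bil (v (y0 - y)) (- B y)) (at (y0 - y) within (\<lambda>y. y0 - y) ` {a<..y0})"
      using v[of "y0 - y"] y unfolding refl by simp
    from vector_diff_chain_within[OF d1 d2] show ?thesis by (simp add: o_def bil.minus_right)
  qed
  then show ?thesis using v v0 refl by (intro exI[of _ "\<lambda>y. v (y0 - y)"]) auto
qed

lemma has_vector_derivative_at_glue:
  fixes f :: "real \<Rightarrow> 'a::real_normed_vector"
  assumes y: "a < y"
    and left: "y \<le> y0 \<Longrightarrow> (f has_vector_derivative f') (at y within {a<..y0})"
    and right: "y0 \<le> y \<Longrightarrow> (f has_vector_derivative f') (at y within {y0..})"
  shows "(f has_vector_derivative f') (at y)"
proof (cases y y0 rule: linorder_cases)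
  case less
  then have "at y within {a<..y0} = at y" using y by (intro at_within_interior) simp
  then show ?thesis using left less by simp
next
  case greater
  then have "at y within {y0..} = at y" by (intro at_within_interior) simp
  then show ?thesis using right greater by simp
next
  case equal
  have "(f has_vector_derivative f') (at y within ({a<..y0} \<union> {y0..}))"
    using left right equal unfolding has_vector_derivative_def has_derivative_within Lim_within_Un by simp
  moreover have "{a<..y0} \<union> {y0..} = {a<..}" using y equal by auto
  moreover have "at y within {a<..} = at y" using y by (intro at_within_open) auto
  ultimately show ?thesis by simp
qed

lemma linear_ode_exists:
  fixes bil :: "'a::euclidean_space \<Rightarrow> 'b::real_normed_vector \<Rightarrow> 'a"
  assumes bil: "bounded_bilinear bil" and y0: "a < y0"
    and B: "continuous_on {a<..} B"
    and S: "subspace S" "u0 \<in> S" "\<And>x y. x \<in> S \<Longrightarrow> a < y \<Longrightarrow> bil x (B y) \<in> S"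
  shows "\<exists>u. u y0 = u0 \<and> (\<forall>y>a. u y \<in> S \<and> (u has_vector_derivative bil (u y) (B y)) (at y))"
proof -
  have "\<exists>u. u y0 = u0 \<and> (\<forall>y\<in>{y0..}. u y \<in> S \<and> (u has_vector_derivative bil (u y) (B y)) (at y within {y0..}))"
  proof (rule linear_ode_exists_right[OF bil])
    show "\<exists>d\<in>{y0..}. y < d" if "y \<in> {y0..}" for y using that by (intro bexI[of _ "y + 1"]) auto
  qed (use y0 S in \<open>auto simp: is_interval_1 intro: continuous_on_subset[OF B]\<close>)
  then obtain uR where uR0: "uR y0 = u0" and uR: "\<And>y. y \<in> {y0..} \<Longrightarrow> uR y \<in> S \<and>
      (uR has_vector_derivative bil (uR y) (B y)) (at y within {y0..})"
    by blast
  have "\<exists>u. u y0 = u0 \<and> (\<forall>y\<in>{a<..y0}. u y \<in> S \<and> (u has_vector_derivative bil (u y) (B y)) (at y within {a<..y0}))"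
    by (rule linear_ode_exists_left[OF bil y0]) (use S in \<open>auto intro: continuous_on_subset[OF B]\<close>)
  then obtain uL where uL0: "uL y0 = u0" and uL: "\<And>y. y \<in> {a<..y0} \<Longrightarrow> uL y \<in> S \<and>
      (uL has_vector_derivative bil (uL y) (B y)) (at y within {a<..y0})"
    by blast
  define u where "u y = (if y0 \<le> y then uR y else uL y)" for y
  have uL_eq: "u y = uL y" if "y \<in> {a<..y0}" for y using that uR0 uL0 by (auto simp: u_def)
  have uR_eq: "u y = uR y" if "y \<in> {y0..}" for y using that by (simp add: u_def)
  have "u y \<in> S \<and> (u has_vector_derivative bil (u y) (B y)) (at y)" if y: "a < y" for y
  proof
    show "u y \<in> S" using uL uR y by (cases "y0 \<le> y") (auto simp: u_def)
    show "(u has_vector_derivative bil (u y) (B y)) (at y)"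
    proof (rule has_vector_derivative_at_glue[OF y])
      assume "y \<le> y0"
      then have yL: "y \<in> {a<..y0}" using y by simp
      have "(u has_vector_derivative bil (uL y) (B y)) (at y within {a<..y0})"
        by (rule has_vector_derivative_transform[OF yL _ conjunct2[OF uL[OF yL]]]) (simp add: uL_eq)
      then show "(u has_vector_derivative bil (u y) (B y)) (at y within {a<..y0})"
        using uL_eq[OF yL] by simp
    next
      assume "y0 \<le> y"
      then have yR: "y \<in> {y0..}" by simp
      have "(u has_vector_derivative bil (uR y) (B y)) (at y within {y0..})"
        by (rule has_vector_derivative_transform[OF yR _ conjunct2[OF uR[OF yR]]]) (simp add: uR_eq)
      then show "(u has_vector_derivative bil (u y) (B y)) (at y within {y0..})"
        using uR_eq[OF yR] by simp
    qed
  qed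
  then show ?thesis using uR0 by (intro exI[of _ u]) (auto simp: u_def)
qed

lemma has_vector_derivative_zero_imp_eq:
  fixes f :: "real \<Rightarrow> 'a::real_normed_vector"
  assumes "a < y0" "a < y" "\<And>y. a < y \<Longrightarrow> (f has_vector_derivative 0) (at y)"
  shows "f y = f y0"
proof -
  have "(f has_vector_derivative 0) (at y within {a<..})" if "y \<in> {a<..}" for y
    using assms(3) that by (simp add: has_vector_derivative_at_within)
  then obtain c where "\<And>y. y \<in> {a<..} \<Longrightarrow> f y = c"
    using has_vector_derivative_zero_constant[of "{a<..}" f] by (metis convex_real_interval(3))
  then show ?thesis using assms(1,2) by simp
qed

lemma has_vector_derivative_matrix_mult:
  fixes f g :: "real \<Rightarrow> complex^'n^'n"
  assumes "(f has_vector_derivative f') (at y)" "(g has_vector_derivative g') (at y)"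
  shows "((\<lambda>y. f y ** g y) has_vector_derivative f y ** g' + f' ** g y) (at y)"
  using bounded_bilinear.has_vector_derivative[OF bounded_bilinear_matrix_mult assms] .

lemma matrix_ode_fundamental_solution:
  fixes B :: "real \<Rightarrow> complex^'n^'n"
  assumes y0: "a < y0" and B: "continuous_on {a<..} B"
    and S: "subspace S" "mat 1 \<in> S" "\<And>X Y. X \<in> S \<Longrightarrow> Y \<in> S \<Longrightarrow> X ** Y \<in> S"
    and BS: "\<And>y. a < y \<Longrightarrow> B y \<in> S"
  obtains U V where "U y0 = mat 1" "V y0 = mat 1"
    "\<And>y. a < y \<Longrightarrow> U y \<in> S \<and> V y \<in> S \<and> U y ** V y = mat 1 \<and> V y ** U y = mat 1"
    "\<And>y. a < y \<Longrightarrow> (U has_vector_derivative U y ** B y) (at y)"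
    "\<And>y. a < y \<Longrightarrow> (V has_vector_derivative (- B y) ** V y) (at y)"
proof -
  have "\<exists>U. U y0 = mat 1 \<and> (\<forall>y>a. U y \<in> S \<and> (U has_vector_derivative U y ** B y) (at y))"
    by (rule linear_ode_exists[OF bounded_bilinear_matrix_mult y0 B S(1,2)]) (use S BS in blast)
  then obtain U where U0: "U y0 = mat 1"
    and U: "\<And>y. a < y \<Longrightarrow> U y \<in> S \<and> (U has_vector_derivative U y ** B y) (at y)" by blast
  have "\<exists>V. V y0 = mat 1 \<and> (\<forall>y>a. V y \<in> S \<and> (V has_vector_derivative (- B y) ** V y) (at y))"
  proof (rule linear_ode_exists[OF bounded_bilinear.flip[OF bounded_bilinear_matrix_mult] y0 _ S(1,2)])
    show "continuous_on {a<..} (\<lambda>y. - B y)" by (rule continuous_on_minus[OF B])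
    show "(- B y) ** X \<in> S" if "X \<in> S" "a < y" for X y
      using S(3)[OF subspace_neg[OF S(1) BS[OF that(2)]] that(1)] .
  qed
  then obtain V where V0: "V y0 = mat 1"
    and V: "\<And>y. a < y \<Longrightarrow> V y \<in> S \<and> (V has_vector_derivative (- B y) ** V y) (at y)" by blast
  have UV: "U y ** V y = mat 1" if y: "a < y" for y
  proof -
    have "((\<lambda>y. U y ** V y) has_vector_derivative 0) (at y)" if "a < y" for y
      using has_vector_derivative_matrix_mult[OF conjunct2[OF U[OF that]] conjunct2[OF V[OF that]]]
      by (simp add: matrix_mult_minus_left matrix_mult_minus_right matrix_mul_assoc)
    then have "U y ** V y = U y0 ** V y0" by (rule has_vector_derivative_zero_imp_eq[OF y0 y])
    then show ?thesis using U0 V0 by simp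
  qed
  show ?thesis
    by (rule that[of U V, OF U0 V0]) (use U V UV matrix_left_right_inverse in blast)+
qed

lemma matrix_ode_unique:
  fixes q U V Z :: "real \<Rightarrow> complex^'n^'n"
  assumes y0: "a < y0" and y: "a < y" and U0: "U y0 = mat 1" and V0: "V y0 = mat 1"
    and VU: "\<And>y. a < y \<Longrightarrow> V y ** U y = mat 1"
    and dq: "\<And>y. a < y \<Longrightarrow> (q has_vector_derivative q y ** Z y) (at y)"
    and dV: "\<And>y. a < y \<Longrightarrow> (V has_vector_derivative (- Z y) ** V y) (at y)"
  shows "q y = q y0 ** U y"
proof -
  have "((\<lambda>y. q y ** V y) has_vector_derivative 0) (at y)" if "a < y" for y
    using has_vector_derivative_matrix_mult[OF dq[OF that] dV[OF that]]
    by (simp add: matrix_mult_minus_left matrix_mult_minus_right matrix_mul_assoc)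
  then have "q y ** V y = q y0 ** V y0" by (rule has_vector_derivative_zero_imp_eq[OF y0 y])
  then have "q y ** (V y ** U y) = q y0 ** U y" using V0 by (simp add: matrix_mul_assoc)
  then show ?thesis using VU[OF y] by simp
qed

lemma lax_solution_conjugate:
  fixes \<beta> U V A :: "real \<Rightarrow> complex^'n^'n"
  assumes y0: "a < y0" and y: "a < y" and U0: "U y0 = mat 1" and V0: "V y0 = mat 1"
    and VU: "\<And>y. a < y \<Longrightarrow> V y ** U y = mat 1"
    and dU: "\<And>y. a < y \<Longrightarrow> (U has_vector_derivative U y ** (- A y)) (at y)"
    and dV: "\<And>y. a < y \<Longrightarrow> (V has_vector_derivative A y ** V y) (at y)"
    and lax: "\<And>y. a < y \<Longrightarrow> (\<beta> has_vector_derivative - lie_bracket (\<beta> y) (A y)) (at y)"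
  shows "\<beta> y = V y ** \<beta> y0 ** U y"
proof -
  have "((\<lambda>y. U y ** \<beta> y ** V y) has_vector_derivative 0) (at y)" if "a < y" for y
    using has_vector_derivative_matrix_mult[OF has_vector_derivative_matrix_mult[OF dU lax] dV, OF that that that]
    by (simp add: lie_bracket_def matrix_mult_minus_left matrix_mult_minus_right matrix_diff_rdistrib
        matrix_diff_ldistrib matrix_add_rdistrib matrix_mul_assoc)
  then have "U y ** \<beta> y ** V y = U y0 ** \<beta> y0 ** V y0" by (rule has_vector_derivative_zero_imp_eq[OF y0 y])
  then have const: "U y ** \<beta> y ** V y = \<beta> y0" using U0 V0 by simp
  have "\<beta> y = (V y ** U y) ** \<beta> y ** (V y ** U y)" using VU[OF y] by simp
  also have "\<dots> = V y ** (U y ** \<beta> y ** V y) ** U y" by (simp add: matrix_mul_assoc)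
  finally show ?thesis by (simp only: const)
qed

section \<open>The matrix exponential\<close>

lemma has_vector_derivative_vec_lambda:
  fixes f :: "real \<Rightarrow> 'a::real_normed_vector^'n"
  assumes "\<And>i. ((\<lambda>t. f t $ i) has_vector_derivative f' $ i) (at x within s)"
  shows "(f has_vector_derivative f') (at x within s)"
proof -
  have "((\<lambda>y. \<chi> i. (1 / norm (y - x)) *\<^sub>R (f y $ i - (f x $ i + (y - x) *\<^sub>R f' $ i))) \<longlongrightarrow> (\<chi> i. 0))
      (at x within s)"
    using assms unfolding has_vector_derivative_def has_derivative_within by (intro tendsto_vec_lambda) blast
  moreover have "(\<lambda>y. \<chi> i. (1 / norm (y - x)) *\<^sub>R (f y $ i - (f x $ i + (y - x) *\<^sub>R f' $ i)))
      = (\<lambda>y. (1 / norm (y - x)) *\<^sub>R (f y - (f x + (y - x) *\<^sub>R f')))"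
    by (simp add: vec_eq_iff fun_eq_iff)
  ultimately show ?thesis
    unfolding has_vector_derivative_def has_derivative_within
    by (auto simp: zero_vec_def intro: bounded_linear_scaleR_left)
qed

lemma matpow_0 [simp]: "matpow A 0 = mat 1"
  by (simp add: matpow_def)

lemma matpow_Suc: "matpow A (Suc n) = A ** matpow A n"
  by (simp add: matpow_def)

lemma matpow_Suc': "matpow A (Suc n) = matpow A n ** A"
  by (induction n) (simp_all add: matpow_Suc matrix_mul_assoc)

lemma cscaleM_cscaleM: "cscaleM a (cscaleM b X) = cscaleM (a * b) X"
  by (simp add: cscaleM_def mult.assoc)

lemma matpow_cscaleM: "matpow (cscaleM c A) n = cscaleM (c ^ n) (matpow A n)"
proof (induction n)
  case 0 then show ?case by (simp add: cscaleM_def mat_def vec_eq_iff)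
next
  case (Suc n) then show ?case
    by (simp add: matpow_Suc cscaleM_mult_left cscaleM_mult_right cscaleM_cscaleM mult.commute)
qed

definition mexp_coeff :: "complex^'n^'n \<Rightarrow> 'n \<Rightarrow> 'n \<Rightarrow> nat \<Rightarrow> complex" where
  "mexp_coeff X i j n = matpow X n $ i $ j / of_nat (fact n)"

lemma mexp_cscaleM_nth: "mexp (cscaleM z X) $ i $ j = (\<Sum>n. mexp_coeff X i j n * z ^ n)"
  unfolding mexp_def mexp_coeff_def matpow_cscaleM by (simp add: cscaleM_def mult_ac)

lemma norm_matpow_nth_le:
  fixes X :: "complex^'n^'n"
  defines "\<rho> \<equiv> 1 + (\<Sum>i\<in>UNIV. \<Sum>j\<in>UNIV. norm (X $ i $ j))"
  shows "norm (matpow X n $ i $ j) \<le> \<rho> ^ n"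
proof (induction n arbitrary: i j)
  case (Suc n)
  have row: "(\<Sum>l\<in>UNIV. norm (X $ i $ l)) \<le> \<rho>"
    using member_le_sum[of i UNIV "\<lambda>i. \<Sum>j\<in>UNIV. norm (X $ i $ j)"] unfolding \<rho>_def
    by (simp add: sum_nonneg)
  have "0 \<le> \<rho>" unfolding \<rho>_def by (simp add: sum_nonneg)
  have "norm (matpow X (Suc n) $ i $ j) = norm (\<Sum>l\<in>UNIV. X $ i $ l * matpow X n $ l $ j)"
    by (simp add: matpow_Suc matrix_matrix_mult_def)
  also have "\<dots> \<le> (\<Sum>l\<in>UNIV. norm (X $ i $ l) * \<rho> ^ n)"
    by (rule order_trans[OF norm_sum sum_mono]) (auto simp: norm_mult intro: mult_left_mono Suc.IH)
  also have "\<dots> \<le> \<rho> * \<rho> ^ n"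
    using row \<open>0 \<le> \<rho>\<close> by (simp add: sum_distrib_right[symmetric] mult_right_mono)
  finally show ?case by simp
qed (simp add: mat_def)

lemma summable_mexp_coeff: "summable (\<lambda>n. mexp_coeff X i j n * z ^ n)"
proof -
  define \<rho> where "\<rho> = 1 + (\<Sum>i\<in>UNIV. \<Sum>j\<in>UNIV. norm (X $ i $ j))"
  have "norm (mexp_coeff X i j n * z ^ n) \<le> inverse (fact n) * (\<rho> * norm z) ^ n" for n
  proof -
    have "norm (mexp_coeff X i j n * z ^ n) = norm (matpow X n $ i $ j) * norm z ^ n / fact n"
      by (simp add: mexp_coeff_def norm_mult norm_divide norm_power)
    also have "\<dots> \<le> \<rho> ^ n * norm z ^ n / fact n"
      using norm_matpow_nth_le[of X n i j] unfolding \<rho>_def by (intro divide_right_mono mult_right_mono) auto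
    finally show ?thesis by (simp add: field_simps)
  qed
  then show ?thesis by (rule summable_comparison_test'[OF summable_exp, of 0])
qed

lemma mexp_cscaleM_zero: "mexp (cscaleM 0 X) = mat 1"
  by (simp add: vec_eq_iff mexp_cscaleM_nth) (simp add: mexp_coeff_def mat_def)

lemma matrix_mult_mexp_cscaleM_nth:
  "(X ** mexp (cscaleM z X)) $ i $ j = (\<Sum>n. matpow X (Suc n) $ i $ j / of_nat (fact n) * z ^ n)"
proof -
  have "(X ** mexp (cscaleM z X)) $ i $ j = (\<Sum>l\<in>UNIV. X $ i $ l * (\<Sum>n. mexp_coeff X l j n * z ^ n))"
    by (simp add: matrix_matrix_mult_def mexp_cscaleM_nth)
  also have "\<dots> = (\<Sum>l\<in>UNIV. \<Sum>n. X $ i $ l * (mexp_coeff X l j n * z ^ n))"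
    by (simp add: suminf_mult[OF summable_mexp_coeff])
  also have "\<dots> = (\<Sum>n. \<Sum>l\<in>UNIV. X $ i $ l * (mexp_coeff X l j n * z ^ n))"
    by (rule suminf_sum[symmetric]) (intro summable_mult summable_mexp_coeff)
  also have "\<dots> = (\<Sum>n. matpow X (Suc n) $ i $ j / of_nat (fact n) * z ^ n)"
    by (rule suminf_cong) (simp add: mexp_coeff_def matpow_Suc matrix_matrix_mult_def sum_divide_distrib
        sum_distrib_left sum_distrib_right mult_ac)
  finally show ?thesis .
qed

lemma mexp_cscaleM_mult_nth:
  "(mexp (cscaleM z X) ** X) $ i $ j = (\<Sum>n. matpow X (Suc n) $ i $ j / of_nat (fact n) * z ^ n)"
proof -
  have "(mexp (cscaleM z X) ** X) $ i $ j = (\<Sum>l\<in>UNIV. (\<Sum>n. mexp_coeff X i l n * z ^ n) * X $ l $ j)"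
    by (simp add: matrix_matrix_mult_def mexp_cscaleM_nth)
  also have "\<dots> = (\<Sum>l\<in>UNIV. \<Sum>n. mexp_coeff X i l n * z ^ n * X $ l $ j)"
    by (simp add: suminf_mult2[OF summable_mexp_coeff])
  also have "\<dots> = (\<Sum>n. \<Sum>l\<in>UNIV. mexp_coeff X i l n * z ^ n * X $ l $ j)"
    by (rule suminf_sum[symmetric]) (intro summable_mult2 summable_mexp_coeff)
  also have "\<dots> = (\<Sum>n. matpow X (Suc n) $ i $ j / of_nat (fact n) * z ^ n)"
    by (rule suminf_cong) (simp add: mexp_coeff_def matpow_Suc' matrix_matrix_mult_def sum_divide_distrib
        sum_distrib_left sum_distrib_right mult_ac)
  finally show ?thesis .
qed

lemma mexp_cscaleM_commute: "X ** mexp (cscaleM z X) = mexp (cscaleM z X) ** X"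
  by (simp add: vec_eq_iff matrix_mult_mexp_cscaleM_nth mexp_cscaleM_mult_nth)

lemma has_vector_derivative_mexp:
  "((\<lambda>t. mexp (cscaleM (of_real t) X)) has_vector_derivative X ** mexp (cscaleM (of_real t) X)) (at t within s)"
proof (rule has_vector_derivative_vec_lambda, rule has_vector_derivative_vec_lambda)
  fix i j
  have "diffs (mexp_coeff X i j) n = matpow X (Suc n) $ i $ j / of_nat (fact n)" for n
  proof -
    have "(of_nat (fact (Suc n)) :: complex) = of_nat (Suc n) * of_nat (fact n)"
      by (simp only: fact_Suc of_nat_mult of_nat_id)
    then show ?thesis unfolding diffs_def mexp_coeff_def by (simp add: field_simps del: of_nat_Suc)
  qed
  moreover have "((\<lambda>z. \<Sum>n. mexp_coeff X i j n * z ^ n) has_field_derivative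
      (\<Sum>n. diffs (mexp_coeff X i j) n * z ^ n)) (at z)" for z
    by (rule termdiffs_strong_converges_everywhere[OF summable_mexp_coeff])
  ultimately have "((\<lambda>z. \<Sum>n. mexp_coeff X i j n * z ^ n) has_field_derivative
      (X ** mexp (cscaleM z X)) $ i $ j) (at z)" for z
    by (simp add: matrix_mult_mexp_cscaleM_nth)
  then show "((\<lambda>t. mexp (cscaleM (of_real t) X) $ i $ j) has_vector_derivative
      (X ** mexp (cscaleM (of_real t) X)) $ i $ j) (at t within s)"
    unfolding mexp_cscaleM_nth by (rule has_vector_derivative_real_field)
qed

lemma has_vector_derivative_mexp_minus:
  "((\<lambda>t. mexp (cscaleM (of_real (- t)) X)) has_vector_derivative - (X ** mexp (cscaleM (of_real (- t)) X))) (at t)"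
proof -
  have "((\<lambda>t. - t) has_vector_derivative -1) (at t)" by (auto intro!: derivative_eq_intros)
  from vector_diff_chain_at[OF this has_vector_derivative_mexp] show ?thesis by (simp add: o_def)
qed

lemma mexp_cscaleM_inverse:
  "mexp (cscaleM (of_real (- t)) X) ** mexp (cscaleM (of_real t) X) = mat 1"
proof -
  define E where "E t = mexp (cscaleM (of_real t) X)" for t
  have "X ** E (- t) = E (- t) ** X" for t unfolding E_def by (rule mexp_cscaleM_commute)
  then have "((\<lambda>t. E (- t) ** E t) has_vector_derivative 0) (at t)" for t
    using has_vector_derivative_matrix_mult[OF has_vector_derivative_mexp_minus[where X=X and t=t]
        has_vector_derivative_mexp[where X=X and t=t and s=UNIV]]
    by (simp add: E_def matrix_mult_minus_left matrix_mul_assoc)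
  then have "E (- t) ** E t = E (- 0) ** E 0"
    by (intro has_vector_derivative_zero_imp_eq[of "min t 0 - 1"]) auto
  then show ?thesis by (simp add: E_def mexp_cscaleM_zero)
qed

lemma mexp_cscaleM_preserves_subspace:
  assumes V: "vec.subspace V" and XV: "\<And>v. v \<in> V \<Longrightarrow> X *v v \<in> V" and v: "v \<in> V"
  shows "mexp (cscaleM z X) *v v \<in> V"
proof -
  have pow: "matpow X n *v v \<in> V" for n
    by (induction n) (simp_all add: v XV matpow_Suc matrix_vector_mul_assoc[symmetric])
  define s where "s N = (\<Sum>n<N. (z ^ n / of_nat (fact n)) *s (matpow X n *v v))" for N
  have "s N \<in> V" for N
    unfolding s_def by (intro vec.subspace_sum[OF V] vec.subspace_scale[OF V] pow)
  moreover have "s \<longlonglongrightarrow> mexp (cscaleM z X) *v v"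
  proof -
    have s_eq: "s N = (\<chi> i. \<Sum>j\<in>UNIV. (\<Sum>n<N. mexp_coeff X i j n * z ^ n) * v $ j)" for N
      unfolding s_def
      by (simp add: vec_eq_iff matrix_vector_mult_def mexp_coeff_def sum_distrib_left
          sum_distrib_right mult_ac sum.swap[of _ "{..<N}"])
    have mexp_eq: "mexp (cscaleM z X) *v v = (\<chi> i. \<Sum>j\<in>UNIV. (\<Sum>n. mexp_coeff X i j n * z ^ n) * v $ j)"
      by (simp add: vec_eq_iff matrix_vector_mult_def mexp_cscaleM_nth)
    show ?thesis
      unfolding s_eq mexp_eq by (intro tendsto_vec_lambda tendsto_sum tendsto_mult_right summable_LIMSEQ
          summable_mexp_coeff)
  qed
  ultimately show ?thesis
    by (rule closed_sequentially[OF closed_subspace[OF vec_subspace_imp_subspace[OF V]]])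
qed

lemma has_vector_derivative_mexp_mult_gauge:
  fixes h :: "real \<Rightarrow> complex^'n^'n"
  assumes dh: "(h has_vector_derivative h y ** (- A)) (at y)" and Nh: "N ** h y = h y ** B"
  defines "E \<equiv> \<lambda>t. mexp (cscaleM (of_real t) (cscaleM \<i> N))"
  shows "((\<lambda>y. E (- y) ** h y) has_vector_derivative (E (- y) ** h y) ** (- A - cscaleM \<i> B)) (at y)"
proof -
  have "- (cscaleM \<i> N ** E (- y)) ** h y = - (E (- y) ** (cscaleM \<i> N ** h y))"
    using mexp_cscaleM_commute[of "cscaleM \<i> N"] by (simp add: E_def matrix_mult_minus_left matrix_mul_assoc)
  also have "\<dots> = - ((E (- y) ** h y) ** cscaleM \<i> B)"
    using Nh by (simp add: cscaleM_mult_left cscaleM_mult_right matrix_mul_assoc)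
  finally show ?thesis
    using has_vector_derivative_matrix_mult[OF has_vector_derivative_mexp_minus dh, of "cscaleM \<i> N"]
    by (simp add: E_def matrix_mult_minus_right matrix_diff_ldistrib matrix_mul_assoc)
qed

section \<open>The gauge\<close>

lemma act_stabilizer_eq:
  assumes "U \<in> stabilizer F" "V \<in> stabilizer F" "U ** V = mat 1"
  shows "act U F = F"
proof -
  have "(\<lambda>v. U *v v) ` F p = F p" for p
  proof
    show "(\<lambda>v. U *v v) ` F p \<subseteq> F p" using assms(1) unfolding stabilizer_def by blast
    show "F p \<subseteq> (\<lambda>v. U *v v) ` F p"
    proof
      fix v assume "v \<in> F p"
      moreover have "v = U *v (V *v v)" using assms(3) by (simp add: matrix_vector_mul_assoc)
      ultimately show "v \<in> (\<lambda>v. U *v v) ` F p" using assms(2) unfolding stabilizer_def by blast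
    qed
  qed
  then show ?thesis unfolding act_def by auto
qed

context split_gpmhs
begin

lemma flow_preserves_Q:
  fixes G C :: "real \<Rightarrow> complex^'n^'n"
  assumes y0: "a < y0" and G0: "G y0 = mat 1"
    and dG: "\<And>y. a < y \<Longrightarrow> (G has_vector_derivative C y ** G y) (at y)"
    and C: "\<And>y. a < y \<Longrightarrow> C y \<in> gClie W Q" and GW: "\<And>y. a < y \<Longrightarrow> G y \<in> stabilizer W"
    and y: "a < y" and x: "x \<in> W k" and z: "z \<in> W k"
  shows "Q k (G y *v x) (G y *v z) = Q k x z"
proof -
  interpret Q: bounded_bilinear "Q k" by (rule cbilinear_imp_bounded_bilinear[OF cbilinear_Q])
  have dGv: "((\<lambda>y. G y *v v) has_vector_derivative C y *v (G y *v v)) (at y)" if "a < y" for y v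
    using bounded_bilinear.has_vector_derivative[OF bounded_bilinear_matrix_vector_mult dG[OF that]
        has_vector_derivative_const[of v]]
    by (simp add: matrix_vector_mul_assoc)
  have "((\<lambda>y. Q k (G y *v x) (G y *v z)) has_vector_derivative 0) (at y)" if "a < y" for y
  proof -
    have "G y *v x \<in> W k" "G y *v z \<in> W k" using GW[OF that] x z unfolding stabilizer_def by auto
    then have "Q k (C y *v (G y *v x)) (G y *v z) + Q k (G y *v x) (C y *v (G y *v z)) = 0"
      using C[OF that] unfolding gClie_def by blast
    then show ?thesis
      using Q.has_vector_derivative[OF dGv[OF that, of x] dGv[OF that, of z]] by (simp add: add.commute)
  qed
  then have "Q k (G y *v x) (G y *v z) = Q k (G y0 *v x) (G y0 *v z)"
    by (rule has_vector_derivative_zero_imp_eq[OF y0 y])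
  then show ?thesis using G0 by simp
qed

lemma mexp_mem_GCgrp:
  assumes X: "X \<in> gClie W Q"
  shows "mexp X \<in> GCgrp W Q"
proof -
  let ?E = "\<lambda>t. mexp (cscaleM (of_real t) X)"
  have E1: "?E 1 = mexp X" by (simp add: cscaleM_def)
  have EW: "?E t \<in> stabilizer W" for t
    unfolding stabilizer_def using X
    by (auto intro: mexp_cscaleM_preserves_subspace[OF subspace_W] simp: gClie_def)
  have "Q k (?E 1 *v x) (?E 1 *v z) = Q k x z" if "x \<in> W k" "z \<in> W k" for k x z
    by (rule flow_preserves_Q[of "-1" 0 ?E "\<lambda>_. X"])
      (use that X EW in \<open>auto simp: mexp_cscaleM_zero has_vector_derivative_mexp\<close>)
  moreover have "invertible (?E 1)"
    unfolding invertible_def using mexp_cscaleM_inverse[of "- 1" X] mexp_cscaleM_inverse[of 1 X] by auto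
  ultimately show ?thesis using EW[of 1] unfolding E1 GCgrp_def stabilizer_def by blast
qed

lemma gauge_mem_Hgrp:
  fixes U V C :: "real \<Rightarrow> complex^'n^'n"
  assumes y0: "a < y0" and V0: "V y0 = mat 1"
    and UV: "\<And>y. a < y \<Longrightarrow> U y \<in> pres_W_real \<and> V y \<in> pres_W_real \<and> U y ** V y = mat 1 \<and> V y ** U y = mat 1"
    and dV: "\<And>y. a < y \<Longrightarrow> (V has_vector_derivative C y ** V y) (at y)"
    and C: "\<And>y. a < y \<Longrightarrow> C y \<in> gClie W Q"
    and y: "a < y"
  shows "U y \<in> Hgrp W Q"
proof -
  have stab: "U y \<in> stabilizer W" "\<And>y. a < y \<Longrightarrow> V y \<in> stabilizer W"
    using UV y unfolding pres_W_real_def by auto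
  have "Q k (U y *v x) (U y *v z) = Q k x z" if "x \<in> W k" "z \<in> W k" for k x z
  proof -
    have "U y *v x \<in> W k" "U y *v z \<in> W k" using stab(1) that unfolding stabilizer_def by auto
    from flow_preserves_Q[OF y0 V0 dV C stab(2) y this] show ?thesis
      using UV[OF y] by (simp add: matrix_vector_mul_assoc)
  qed
  moreover have real2: "cnjv (U y *v x) - U y *v cnjv x \<in> W (k - 2)" if "x \<in> W k" for k x
    using UV[OF y] that unfolding pres_W_real_def by blast
  moreover have "cnjv (U y *v x) - U y *v cnjv x \<in> W (k - 1)" if "x \<in> W k" for k x
    using W_mono[OF _ real2[OF that]] by simp
  moreover have "invertible (U y)" unfolding invertible_def using UV[OF y] by blast
  ultimately show ?thesis
    using stab(1) unfolding Hgrp_def Ggrp_def GCgrp_def stabilizer_def by blast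
qed

lemma gauge_exists:
  fixes \<beta> :: "real \<Rightarrow> complex^'n^'n"
  assumes y0: "a < y0" and \<beta>: "continuous_on {a<..} \<beta>" and \<beta>h: "\<And>y. a < y \<Longrightarrow> \<beta> y \<in> hlie W Q"
  obtains h g where "h y0 = mat 1" "g y0 = mat 1"
    "\<And>y. a < y \<Longrightarrow> h y \<in> Hgrp W Q \<and> g y ** h y = mat 1"
    "\<And>y. a < y \<Longrightarrow> (h has_vector_derivative h y ** (- Lop I (\<beta> y))) (at y)"
    "\<And>y. a < y \<Longrightarrow> (g has_vector_derivative Lop I (\<beta> y) ** g y) (at y)"
proof -
  have Lh: "Lop I (\<beta> y) \<in> gClie W Q \<inter> pres_W_real" if "a < y" for y
    using Lop_hlie[OF \<beta>h[OF that]] hlie_eq by blast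
  have "continuous_on {a<..} (\<lambda>y. - Lop I (\<beta> y))"
    by (intro continuous_on_minus continuous_on_compose2[OF linear_continuous_on[OF bounded_linear_Lop] \<beta>]) auto
  then obtain U V where U0: "U y0 = mat 1" and V0: "V y0 = mat 1"
    and UV: "\<And>y. a < y \<Longrightarrow> U y \<in> pres_W_real \<and> V y \<in> pres_W_real \<and> U y ** V y = mat 1 \<and> V y ** U y = mat 1"
    and dU: "\<And>y. a < y \<Longrightarrow> (U has_vector_derivative U y ** (- Lop I (\<beta> y))) (at y)"
    and dV: "\<And>y. a < y \<Longrightarrow> (V has_vector_derivative (- (- Lop I (\<beta> y))) ** V y) (at y)"
    using matrix_ode_fundamental_solution[OF y0 _ subspace_pres_W_real mat_1_pres_W_real pres_W_real_mult,
        of "\<lambda>y. - Lop I (\<beta> y)"] Lh subspace_neg[OF subspace_pres_W_real] by blast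
  have dV': "(V has_vector_derivative Lop I (\<beta> y) ** V y) (at y)" if "a < y" for y
    using dV[OF that] by simp
  have "U y \<in> Hgrp W Q" if "a < y" for y
    using gauge_mem_Hgrp[where U=U and V=V and C="\<lambda>y. Lop I (\<beta> y)", OF y0 V0 UV dV' _ that] Lh by blast
  then show ?thesis using that[of U V, OF U0 V0] UV dU dV' by blast
qed

lemma lax_gauge:
  fixes \<beta> :: "real \<Rightarrow> complex^'n^'n"
  assumes y0: "a < y0" and \<beta>: "continuous_on {a<..} \<beta>" and \<beta>h: "\<And>y. a < y \<Longrightarrow> \<beta> y \<in> hlie W Q"
    and lax: "\<And>y. a < y \<Longrightarrow> (\<beta> has_vector_derivative - lie_bracket (\<beta> y) (Lop I (\<beta> y))) (at y)"
  obtains h where "h y0 = mat 1"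
    "\<And>y. a < y \<Longrightarrow> h y \<in> Hgrp W Q \<and> matrix_inv (h y) ** h y = mat 1 \<and>
      (h has_vector_derivative h y ** (- Lop I (\<beta> y))) (at y)"
    "\<And>y. a < y \<Longrightarrow> \<beta> y = matrix_inv (h y) ** \<beta> y0 ** h y \<and> \<beta> y0 ** h y = h y ** \<beta> y"
proof -
  obtain h g where h0: "h y0 = mat 1" and g0: "g y0 = mat 1"
    and hg: "\<And>y. a < y \<Longrightarrow> h y \<in> Hgrp W Q \<and> g y ** h y = mat 1"
    and dh: "\<And>y. a < y \<Longrightarrow> (h has_vector_derivative h y ** (- Lop I (\<beta> y))) (at y)"
    and dg: "\<And>y. a < y \<Longrightarrow> (g has_vector_derivative Lop I (\<beta> y) ** g y) (at y)"
    using gauge_exists[OF y0 \<beta> \<beta>h] by blast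
  have inv: "matrix_inv (h y) = g y" "h y ** g y = mat 1" if "a < y" for y
    using hg[OF that] matrix_inv_eq matrix_left_right_inverse by blast+
  have conj: "\<beta> y = g y ** \<beta> y0 ** h y" if "a < y" for y
    by (rule lax_solution_conjugate[OF y0 that h0 g0 _ dh dg]) (use hg lax in auto)
  have Nh: "\<beta> y0 ** h y = h y ** \<beta> y" if "a < y" for y
  proof -
    have "h y ** \<beta> y = (h y ** g y) ** \<beta> y0 ** h y"
      by (subst conj[OF that]) (simp add: matrix_mul_assoc)
    then show ?thesis using inv(2)[OF that] by simp
  qed
  show ?thesis
  proof (rule that[of h, OF h0])
    fix y assume y: "a < y"
    show "h y \<in> Hgrp W Q \<and> matrix_inv (h y) ** h y = mat 1 \<and>
        (h has_vector_derivative h y ** (- Lop I (\<beta> y))) (at y)"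
      using hg[OF y] inv(1)[OF y] dh[OF y] by simp
    show "\<beta> y = matrix_inv (h y) ** \<beta> y0 ** h y \<and> \<beta> y0 ** h y = h y ** \<beta> y"
      using conj[OF y] inv(1)[OF y] Nh[OF y] by simp
  qed
qed

text \<open>\<open>q(y) = e\<^sup>-\<^sup>i\<^sup>y\<^sup>N h(y)\<close> solves \<open>q' = - q (i\<beta> + L\<beta>)\<close>, an equation with coefficients stabilizing
  \<open>Fo\<close>; so \<open>q(y) = q(y\<^sub>0) \<rho>(y)\<close> with \<open>\<rho>(y)\<close> fixing \<open>Fo\<close>.\<close>
lemma gauge_orbit:
  fixes h \<beta> :: "real \<Rightarrow> complex^'n^'n" and N :: "complex^'n^'n"
  assumes y0: "a < y0" and h0: "h y0 = mat 1"
    and dh: "\<And>y. a < y \<Longrightarrow> (h has_vector_derivative h y ** (- Lop I (\<beta> y))) (at y)"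
    and Nh: "\<And>y. a < y \<Longrightarrow> N ** h y = h y ** \<beta> y"
    and \<beta>: "continuous_on {a<..} \<beta>"
    and y: "a < y"
  shows "act (h y) Fo = act (mexp (cscaleM (\<i> * of_real y) N)) (act (mexp (cscaleM (\<i> * of_real (- y0)) N)) Fo)"
proof -
  define Z where "Z y = - Lop I (\<beta> y) - cscaleM \<i> (\<beta> y)" for y
  have ZF: "Z y \<in> stabilizer Fo" for y
    using subspace_neg[OF subspace_stabilizer[OF subspace_Fo] i_plus_Lop_stabilizer_Fo]
    by (simp add: Z_def add.commute)
  have "continuous_on {a<..} Z"
    unfolding Z_def cscaleM_eq_mat_mult
    by (intro continuous_on_minus continuous_on_diff continuous_on_const \<beta>
        bounded_bilinear.continuous_on[OF bounded_bilinear_matrix_mult]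
        continuous_on_compose2[OF linear_continuous_on[OF bounded_linear_Lop] \<beta>]) auto
  then obtain \<rho> \<sigma> where \<rho>0: "\<rho> y0 = mat 1" and \<sigma>0: "\<sigma> y0 = mat 1"
    and \<rho>\<sigma>: "\<And>y. a < y \<Longrightarrow> \<rho> y \<in> stabilizer Fo \<and> \<sigma> y \<in> stabilizer Fo \<and> \<rho> y ** \<sigma> y = mat 1 \<and> \<sigma> y ** \<rho> y = mat 1"
    and d\<sigma>: "\<And>y. a < y \<Longrightarrow> (\<sigma> has_vector_derivative (- Z y) ** \<sigma> y) (at y)"
    by (rule matrix_ode_fundamental_solution[where B=Z and S="stabilizer Fo", OF y0 _
          subspace_stabilizer[OF subspace_Fo] mat_1_stabilizer stabilizer_mult ZF]) blast+
  define X where "X = cscaleM \<i> N"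
  define E where "E t = mexp (cscaleM (of_real t) X)" for t
  have E_eq: "E t = mexp (cscaleM (\<i> * of_real t) N)" for t
    by (simp add: E_def X_def cscaleM_cscaleM mult.commute)
  have dq: "((\<lambda>y. E (- y) ** h y) has_vector_derivative (E (- y) ** h y) ** Z y) (at y)" if "a < y" for y
    using has_vector_derivative_mexp_mult_gauge[OF dh[OF that] Nh[OF that]] by (simp add: E_def X_def Z_def)
  have "E (- y) ** h y = (E (- y0) ** h y0) ** \<rho> y"
    by (rule matrix_ode_unique[where q="\<lambda>y. E (- y) ** h y" and Z=Z and U=\<rho> and V=\<sigma>, OF y0 y \<rho>0 \<sigma>0 _ dq d\<sigma>]) (use \<rho>\<sigma> in blast)
  then have "E y ** (E (- y) ** h y) = E y ** E (- y0) ** \<rho> y" using h0 by (simp add: matrix_mul_assoc)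
  then have "h y = E y ** E (- y0) ** \<rho> y"
    using mexp_cscaleM_inverse[of "- y" X] by (simp add: E_def matrix_mul_assoc)
  then show ?thesis
    using act_stabilizer_eq[of "\<rho> y" Fo "\<sigma> y"] \<rho>\<sigma>[OF y] by (simp add: act_matrix_mult E_eq)
qed

end

theorem theorem7p1:
  fixes W :: "int \<Rightarrow> (complex^'n) set"
    and Q :: "int \<Rightarrow> complex^'n \<Rightarrow> complex^'n \<Rightarrow> complex"
    and d :: "int \<Rightarrow> nat"
    and Fo :: "int \<Rightarrow> (complex^'n) set"
    and I :: "int \<Rightarrow> int \<Rightarrow> (complex^'n) set"
    and \<beta> :: "real \<Rightarrow> complex^'n^'n"
    and a :: real
  assumes W: "rational_inc_filtration W"
    and Q: "graded_polarization W Q"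
    and Fo: "Fo \<in> Mset W Q d"
    and I: "deligne_bigrading Fo W I"
    and split: "split_over_R I"
    and beta_h: "\<forall>y>a. \<beta> y \<in> hlie W Q"
    and lax: "\<forall>y>a. (\<beta> has_vector_derivative - lie_bracket (\<beta> y) (Lop I (\<beta> y))) (at y)"
  shows "\<exists>(h :: real \<Rightarrow> complex^'n^'n) Nt Ft.
           Nt \<in> hlie W Q \<and> Ft \<in> Mcheck W Q d \<and>
           (\<forall>y>a. h y \<in> Hgrp W Q \<and>
              (\<exists>h'. (h has_vector_derivative h') (at y) \<and>
                    matrix_inv (h y) ** h' = - Lop I (\<beta> y)) \<and>
              \<beta> y = matrix_inv (h y) ** Nt ** h y \<and>
              act (h y) Fo = act (mexp (cscaleM (\<i> * of_real y) Nt)) Ft)"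
proof -
  interpret split_gpmhs W Q d Fo I by unfold_locales (fact W Q Fo I split)+
  have y0: "a < a + 1" by simp
  have \<beta>: "continuous_on {a<..} \<beta>"
    using lax by (intro continuous_at_imp_continuous_on) (auto intro: has_vector_derivative_continuous)
  obtain h where h0: "h (a + 1) = mat 1"
    and h: "\<And>y. a < y \<Longrightarrow> h y \<in> Hgrp W Q \<and> matrix_inv (h y) ** h y = mat 1 \<and>
      (h has_vector_derivative h y ** (- Lop I (\<beta> y))) (at y)"
    and conj: "\<And>y. a < y \<Longrightarrow> \<beta> y = matrix_inv (h y) ** \<beta> (a + 1) ** h y \<and> \<beta> (a + 1) ** h y = h y ** \<beta> y"
    using lax_gauge[OF y0 \<beta>] beta_h lax by blast
  define Ft where "Ft = act (mexp (cscaleM (\<i> * of_real (- (a + 1))) (\<beta> (a + 1)))) Fo"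
  have Nt: "\<beta> (a + 1) \<in> hlie W Q" using beta_h by simp
  then have "Ft \<in> Mcheck W Q d"
    unfolding Mcheck_def Ft_def hlie_eq using Fo by (blast intro: mexp_mem_GCgrp gClie_cscaleM)
  moreover have "act (h y) Fo = act (mexp (cscaleM (\<i> * of_real y) (\<beta> (a + 1)))) Ft" if "a < y" for y
    unfolding Ft_def
    by (rule gauge_orbit[where h=h and N="\<beta> (a + 1)", OF y0 h0 _ _ \<beta> that]) (use h conj in blast)+
  moreover have "\<exists>h'. (h has_vector_derivative h') (at y) \<and> matrix_inv (h y) ** h' = - Lop I (\<beta> y)"
    if "a < y" for y
    using h[OF that] by (intro exI[of _ "h y ** (- Lop I (\<beta> y))"]) (simp add: matrix_mul_assoc)
  ultimately show ?thesis
    using Nt h conj by (intro exI[of _ h] exI[of _ "\<beta> (a + 1)"] exI[of _ Ft]) blast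
qed

end
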